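(* Assume the Continuum Hypothesis. Then every productively Lindelöf sequential $T_3$ space is powerfully Lindelöf.
   Context: A topological space is productively Lindelöf if its product with every Lindelöf space is Lindelöf. A space $X$ is powerfully Lindelöf if its countable power $X^\omega$ (with the Tychonoff product topology) is Lindelöf. *)

theory Defs
  imports "HOL-Analysis.Analysis" "HOL-Library.Equipollence"
begin

definition continuum_hypothesis :: bool where
  "continuum_hypothesis \<longleftrightarrow> (\<forall>A :: real set. uncountable A \<longrightarrow> A \<approx> (UNIV :: real set))"

definition sequential_space :: "'a topology \<Rightarrow> bool" where
  "sequential_space X \<longleftrightarrow>
     (\<forall>S. S \<subseteq> topspace X \<and>
          (\<forall>\<sigma> l. range \<sigma> \<subseteq> S \<and> limitin X \<sigma> l sequentially \<longrightarrow> l \<in> S)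
          \<longrightarrow> closedin X S)"

definition T3_space :: "'a topology \<Rightarrow> bool" where
  "T3_space X \<longleftrightarrow> regular_space X \<and> t1_space X"

definition productively_Lindelof :: "'b itself \<Rightarrow> 'a topology \<Rightarrow> bool" where
  "productively_Lindelof _ X \<longleftrightarrow>
     (\<forall>Y :: 'b topology. Lindelof_space Y \<longrightarrow> Lindelof_space (prod_topology X Y))"

definition powerfully_Lindelof :: "'a topology \<Rightarrow> bool" where
  "powerfully_Lindelof X \<longleftrightarrow> Lindelof_space (product_topology (\<lambda>_::nat. X) UNIV)"

end

theory Submission
  imports Defs
begin

text \<open>Suppose that an open cover of \<open>X\<^sup>\<omega>\<close> has no countable subcover. Closing off a point under
  limits of sequences and under the choice of points outside countable subfamilies gives a set \<open>A\<close>
  of size at most continuum; it is closed because \<open>X\<close> is sequential, so it inherits productive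
  Lindelofness. Continuum many real functions then map \<open>A\<close> onto a subset \<open>Z\<close> of a cube of
  weight continuum to which the bad cover descends, so \<open>Z\<^sup>\<omega>\<close> is not Lindelof either.

  By a theorem of Alster, under the Continuum Hypothesis such a \<open>Z\<close> has the following property:
  if every compact subset of \<open>Z\<close> is enlarged to a \<open>G\<^sub>\<delta>\<close> set, then countably many of these sets
  cover \<open>Z\<close>. It makes \<open>Z\<^sup>\<omega>\<close> Lindelof, a contradiction. Alster's theorem follows from
  Michael-type Lindelof spaces: given a bad assignment, pick \<open>\<omega>\<^sub>1\<close> many points of \<open>Z\<close> escaping countably
  many of the \<open>G\<^sub>\<delta>\<close> sets at a time, isolate them, and add points of the cube outside \<open>Z\<close>, each
  seen only through countably many coordinates.\<close>

section \<open>Sets of size at most continuum\<close>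

text \<open>The weight bound is what makes the Continuum Hypothesis usable. Over the index type
  \<open>real\<close>, the closed subsets of the cube that depend on countably many coordinates are
  named by sequences of finite rational constraints, so there are only continuum many of them.
  Enumerated along an order with countable initial segments, they confront each stage of a
  transfinite choice with countably many requirements only. \<open>X\<close> may have too many open
  sets for this, hence the passage to \<open>A\<close>. Sequentiality lets so small a set be closed:
  taking limits of sequences is an operation of countable arity, and a set of size continuum has
  only continuum many sequences. The map to the cube need not be injective. Its coordinates are the
  functions that describe the bad cover, so the relevant basic sets are preimages, and that is all
  that has to descend. \<open>G\<^sub>\<delta>\<close> sets occur instead of open ones because the
  argument for the power intersects countably many neighbourhoods of each factor already
  chosen.\<close>

lemma lepoll_UNIV_iff_inj: "(UNIV :: 'a set) \<lesssim> (UNIV :: 'b set) \<longleftrightarrow> (\<exists>f :: 'a \<Rightarrow> 'b. inj f)"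
  by (auto simp: lepoll_def)

lemma sequences_lepoll_real:
  assumes "(UNIV :: 'a set) \<lesssim> (UNIV :: real set)"
  shows "(UNIV :: (nat \<Rightarrow> 'a) set) \<lesssim> (UNIV :: real set)"
proof -
  have "(UNIV :: 'a set) \<lesssim> (UNIV :: nat set set)"
    using assms nat_sets_eqpoll_reals eqpoll_sym lepoll_trans2 by blast
  then obtain g :: "'a \<Rightarrow> nat set" where g: "inj g"
    by (auto simp: lepoll_UNIV_iff_inj)
  define h :: "(nat \<Rightarrow> 'a) \<Rightarrow> nat set" where
    "h = (\<lambda>f. {prod_encode (n, k) |n k. k \<in> g (f n)})"
  have "inj h"
  proof (rule injI)
    fix f f' assume eq: "h f = h f'"
    have mem: "prod_encode (n, k) \<in> h u \<longleftrightarrow> k \<in> g (u n)" for n k u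
      by (auto simp: h_def)
    have "g (f n) = g (f' n)" for n
      using eq mem by blast
    then show "f = f'"
      using g by (auto simp: inj_def)
  qed
  then show ?thesis
    using nat_sets_eqpoll_reals lepoll_trans2 lepoll_UNIV_iff_inj by blast
qed

lemma pairs_lepoll_real:
  assumes "(UNIV :: 'a set) \<lesssim> (UNIV :: real set)" "(UNIV :: 'b set) \<lesssim> (UNIV :: real set)"
  shows "(UNIV :: ('a \<times> 'b) set) \<lesssim> (UNIV :: real set)"
proof -
  obtain f :: "'a \<Rightarrow> real" and g :: "'b \<Rightarrow> real" where fg: "inj f" "inj g"
    using assms by (auto simp: lepoll_UNIV_iff_inj)
  define h :: "'a \<times> 'b \<Rightarrow> nat \<Rightarrow> real" where
    "h = (\<lambda>p n. if n = 0 then f (fst p) else g (snd p))"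
  have "inj h"
  proof (rule injI)
    fix p q assume eq: "h p = h q"
    have "f (fst p) = f (fst q)" "g (snd p) = g (snd q)"
      using fun_cong[OF eq, of 0] fun_cong[OF eq, of 1] by (auto simp: h_def)
    then show "p = q"
      using fg by (auto simp: inj_def prod_eq_iff)
  qed
  then have "(UNIV :: ('a \<times> 'b) set) \<lesssim> (UNIV :: (nat \<Rightarrow> real) set)"
    by (auto simp: lepoll_UNIV_iff_inj)
  then show ?thesis
    using lepoll_trans sequences_lepoll_real[OF lepoll_refl] by blast
qed

lemma lists_lepoll_real:
  assumes "(UNIV :: 'a set) \<lesssim> (UNIV :: real set)"
  shows "(UNIV :: 'a list set) \<lesssim> (UNIV :: real set)"
proof -
  define h :: "'a list \<Rightarrow> nat \<times> (nat \<Rightarrow> 'a)" where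
    "h = (\<lambda>xs. (length xs, \<lambda>n. if n < length xs then xs ! n else undefined))"
  have "inj h"
    by (rule injI) (auto simp: h_def fun_eq_iff intro!: nth_equalityI split: if_splits)
  moreover have "(UNIV :: (nat \<times> (nat \<Rightarrow> 'a)) set) \<lesssim> (UNIV :: real set)"
    by (intro pairs_lepoll_real sequences_lepoll_real assms)
       (auto simp: lepoll_UNIV_iff_inj intro!: exI[of _ real] inj_of_nat)
  ultimately show ?thesis
    using lepoll_trans lepoll_UNIV_iff_inj by blast
qed

lemma countable_type_lepoll_real: "(UNIV :: 'a :: countable set) \<lesssim> (UNIV :: real set)"
proof -
  have "inj (real \<circ> (to_nat :: 'a \<Rightarrow> nat))"
    by (intro inj_compose inj_of_nat) auto
  then show ?thesis
    by (auto simp: lepoll_UNIV_iff_inj)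
qed

text \<open>A well-order of the reals all of whose proper initial segments are countable stands in for
  \<open>\<omega>\<^sub>1\<close>.\<close>

definition omega1_order :: "(real \<Rightarrow> real \<Rightarrow> bool) \<Rightarrow> bool" where
  "omega1_order lt \<longleftrightarrow>
     wfp lt \<and> transp lt \<and> (\<forall>a b. lt a b \<or> a = b \<or> lt b a) \<and> (\<forall>b. countable {a. lt a b})"

text \<open>Proper initial segments of the cardinal order of the reals have size below the
  continuum, so they are countable. This is the point where the Continuum Hypothesis enters.\<close>

lemma omega1_order_exists:
  assumes "continuum_hypothesis"
  shows "\<exists>lt. omega1_order lt"
proof -
  define r where "r = card_of (UNIV :: real set)"
  have wo: "Well_order r" and co: "Card_order r" and fld: "Field r = UNIV"
    unfolding r_def by (rule card_of_Well_order card_of_Card_order Field_card_of)+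
  define lt where "lt = (\<lambda>a b. (a, b) \<in> r - Id)"
  have wf: "wf (r - Id)"
    using wo by (simp add: well_order_on_def)
  have lin: "linear_order_on UNIV r"
    using wo fld by (simp add: well_order_on_def)
  have tot: "lt a b \<or> a = b \<or> lt b a" for a b
    using lin by (auto simp: lt_def linear_order_on_def total_on_def)
  have tr: "transp lt"
    using lin unfolding lt_def linear_order_on_def partial_order_on_def preorder_on_def
    by (auto simp: transp_def trans_def antisym_def)
  have cnt: "countable {a. lt a b}" for b
  proof (rule ccontr)
    assume "uncountable {a. lt a b}"
    then have "{a. lt a b} \<approx> (UNIV :: real set)"
      using assms by (auto simp: continuum_hypothesis_def)
    moreover have "{a. lt a b} = underS r b"
      by (auto simp: lt_def underS_def)
    ultimately have "ordIso2 (card_of (underS r b)) (card_of (UNIV :: real set))"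
      by (simp add: eqpoll_iff_card_of_ordIso)
    moreover have "ordLess2 (card_of (underS r b)) r"
      using co fld by (simp add: card_of_underS)
    ultimately show False
      unfolding r_def using not_ordLess_ordIso by blast
  qed
  have "wfp lt"
  proof -
    have "{(a, b). lt a b} = r - Id"
      by (auto simp: lt_def)
    then show ?thesis
      using wf by (simp add: wfp_def)
  qed
  then show ?thesis
    unfolding omega1_order_def using tot tr cnt by (intro exI[of _ lt]) simp
qed

text \<open>Regularity of \<omega>1: the downward closure of \<open>B\<close> is a countable union
  of countable sets, and by totality any real outside it is an upper bound.\<close>

lemma omega1_order_bound:
  assumes "omega1_order lt" "countable B"
  obtains d where "\<And>b. b \<in> B \<Longrightarrow> lt b d"
proof -
  have "countable (\<Union>b\<in>B. insert b {a. lt a b})"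
    using assms by (intro countable_UN) (auto simp: omega1_order_def)
  then have "(\<Union>b\<in>B. insert b {a. lt a b}) \<noteq> UNIV"
    using uncountable_UNIV_real by metis
  then obtain d where "d \<notin> (\<Union>b\<in>B. insert b {a. lt a b})"
    by blast
  then have "lt b d" if "b \<in> B" for b
    using that assms(1) unfolding omega1_order_def by blast
  then show thesis
    using that by blast
qed

lemma omega1_order_least:
  assumes "omega1_order lt" "P d"
  obtains m where "P m" "\<And>c. lt c m \<Longrightarrow> \<not> P c"
proof -
  have "wfp lt" "Collect P \<noteq> {}"
    using assms by (auto simp: omega1_order_def)
  then have "\<exists>m\<in>Collect P. \<forall>c. lt c m \<longrightarrow> c \<notin> Collect P"
    using wfp_iff_ex_minimal[THEN iffD1, of lt, THEN spec, of "Collect P"] by simp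
  then show thesis
    using that by auto
qed

lemma select_uncountable:
  fixes G :: "real \<Rightarrow> 'a set"
  assumes lt: "omega1_order lt" and cover: "Z \<subseteq> (\<Union>b. G b)"
    and none: "\<And>B. countable B \<Longrightarrow> \<not> Z \<subseteq> (\<Union>b\<in>B. G b)"
  obtains A where "A \<subseteq> Z" "uncountable A" "\<And>b. countable (A \<inter> G b)"
proof -
  have "\<exists>x. x \<in> Z \<and> (\<forall>b. lt b a \<longrightarrow> x \<notin> G b)" for a
    using none[of "{b. lt b a}"] lt by (auto simp: omega1_order_def)
  then obtain x where x: "\<And>a. x a \<in> Z" "\<And>a b. lt b a \<Longrightarrow> x a \<notin> G b"
    by metis
  have 1: "countable (range x \<inter> G b)" for b
  proof (rule countable_subset)
    show "range x \<inter> G b \<subseteq> x ` insert b {a. lt a b}"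
    proof
      fix y assume "y \<in> range x \<inter> G b"
      then obtain a where "y = x a" "\<not> lt b a"
        using x(2) by blast
      then show "y \<in> x ` insert b {a. lt a b}"
        using lt unfolding omega1_order_def by blast
    qed
    show "countable (x ` insert b {a. lt a b})"
      using lt by (auto simp: omega1_order_def)
  qed
  have 2: "uncountable (range x)"
  proof
    assume "countable (range x)"
    have "\<forall>z\<in>range x. \<exists>b. z \<in> G b"
      using x(1) cover by blast
    then obtain f where f: "\<And>z. z \<in> range x \<Longrightarrow> z \<in> G (f z)"
      by metis
    obtain d where d: "\<And>b. b \<in> f ` range x \<Longrightarrow> lt b d"
      using omega1_order_bound[OF lt countable_image[OF \<open>countable (range x)\<close>]] by metis
    have "lt (f (x d)) d"
      using d by simp
    with f[of "x d"] x(2) show False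
      by simp
  qed
  show thesis
    using that[of "range x"] x(1) 1 2 by blast
qed

section \<open>Codes and cylinders in the cube\<close>

definition cube :: "('i \<Rightarrow> real) set" where
  "cube = {f. \<forall>i. f i \<in> {0..1}}"

text \<open>Basic open sets are handled through names, so that counting sets becomes counting lists;
  a countable set of coordinates supports only countably many names.\<close>

type_synonym 'i code = "('i \<times> rat \<times> rat) list"

definition rat_box :: "'i code \<Rightarrow> ('i \<Rightarrow> real) set" where
  "rat_box c = {f. \<forall>(i, a, b)\<in>set c. of_rat a < f i \<and> f i < of_rat b}"

definition closed_rat_box :: "'i code \<Rightarrow> ('i \<Rightarrow> real) set" where
  "closed_rat_box c = {f. \<forall>(i, a, b)\<in>set c. of_rat a \<le> f i \<and> f i \<le> of_rat b}"

definition supp :: "'i code \<Rightarrow> 'i set" where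
  "supp c = fst ` set c"

lemma rat_box_Nil [simp]: "rat_box [] = UNIV"
  by (simp add: rat_box_def)

lemma rat_box_append [simp]: "rat_box (c @ d) = rat_box c \<inter> rat_box d"
  unfolding rat_box_def set_append ball_Un by blast

lemma supp_Nil [simp]: "supp [] = {}"
  by (simp add: supp_def)

lemma supp_append [simp]: "supp (c @ d) = supp c \<union> supp d"
  by (auto simp: supp_def)

lemma finite_supp: "finite (supp c)"
  by (simp add: supp_def)

lemma rat_box_Cons: "rat_box (p # c) = {f. of_rat (fst (snd p)) < f (fst p)} \<inter> {f. f (fst p) < of_rat (snd (snd p))} \<inter> rat_box c"
  by (cases p) (auto simp: rat_box_def)

lemma closed_rat_box_Cons:
  "closed_rat_box (p # c) =
     {f. of_rat (fst (snd p)) \<le> f (fst p)} \<inter> {f. f (fst p) \<le> of_rat (snd (snd p))} \<inter> closed_rat_box c"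
  by (cases p) (auto simp: closed_rat_box_def)

lemma continuous_coordinate: "continuous_on UNIV (\<lambda>f :: 'i \<Rightarrow> real. f i)"
  by (rule continuous_on_product_coordinates)

lemma open_rat_box: "open (rat_box c)"
proof (induction c)
  case Nil
  show ?case
    by simp
next
  case (Cons p c)
  show ?case
    unfolding rat_box_Cons
    by (rule open_Int[OF open_Int[OF open_Collect_less open_Collect_less] Cons.IH];
        rule continuous_on_const continuous_coordinate)
qed

lemma closed_closed_rat_box: "closed (closed_rat_box c)"
proof (induction c)
  case Nil
  show ?case
    by (simp add: closed_rat_box_def)
next
  case (Cons p c)
  show ?case
    unfolding closed_rat_box_Cons
    by (rule closed_Int[OF closed_Int[OF closed_Collect_le closed_Collect_le] Cons.IH];
        rule continuous_on_const continuous_coordinate)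
qed

lemma rat_box_subset_closed_rat_box: "rat_box c \<subseteq> closed_rat_box c"
  by (fastforce simp: rat_box_def closed_rat_box_def)

lemma rat_box_cong:
  assumes "f \<in> rat_box c" "\<And>i. i \<in> supp c \<Longrightarrow> f i = g i"
  shows "g \<in> rat_box c"
  using assms by (force simp: rat_box_def supp_def)

text \<open>A harmless member that keeps families of codes non-empty, so that
  \<open>from_nat_into\<close> can enumerate them.\<close>

lemma empty_rat_box_code: "rat_box [(i, 0, 0)] = {}"
  by (auto simp: rat_box_def)

text \<open>Regularity of the base. Since the support is kept, shrinking never leaves a given set of
  coordinates.\<close>

lemma rat_box_shrink:
  assumes "f \<in> rat_box d"
  obtains c where "supp c = supp d" "f \<in> rat_box c" "closed_rat_box c \<subseteq> rat_box d"
proof -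
  have "\<exists>c. supp c = supp d \<and> f \<in> rat_box c \<and> closed_rat_box c \<subseteq> rat_box d"
    using assms
  proof (induction d)
    case Nil
    show ?case
      by (rule exI[of _ "[]"]) (simp add: closed_rat_box_def)
  next
    case (Cons p d)
    obtain i a b where p: "p = (i, a, b)"
      by (cases p) auto
    have fi: "of_rat a < f i" "f i < of_rat b" "f \<in> rat_box d"
      using Cons.prems by (auto simp: p rat_box_Cons)
    obtain a' where a': "of_rat a < real_of_rat a'" "real_of_rat a' < f i"
      using of_rat_dense[OF fi(1)] by blast
    obtain b' where b': "f i < real_of_rat b'" "real_of_rat b' < of_rat b"
      using of_rat_dense[OF fi(2)] by blast
    obtain c where c: "supp c = supp d" "f \<in> rat_box c" "closed_rat_box c \<subseteq> rat_box d"
      using Cons.IH fi(3) by blast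
    have "closed_rat_box ((i, a', b') # c) \<subseteq> rat_box (p # d)"
      using a' b' c(3) by (auto simp: p rat_box_Cons closed_rat_box_Cons)
    moreover have "f \<in> rat_box ((i, a', b') # c)"
      using a' b' c(2) by (auto simp: rat_box_Cons)
    moreover have "supp ((i, a', b') # c) = supp (p # d)"
      using c(1) by (simp add: supp_def p)
    ultimately show ?case
      by blast
  qed
  then show thesis
    using that by blast
qed

lemma rat_box_basis:
  assumes "open U" "f \<in> U"
  obtains c where "f \<in> rat_box c" "rat_box c \<subseteq> U"
proof -
  obtain X where X: "f \<in> PiE UNIV X" "\<And>i. open (X i)" "finite {i. X i \<noteq> UNIV}" "PiE UNIV X \<subseteq> U"
    using product_topology_open_contains_basis[of "\<lambda>_. euclidean" UNIV U f] assms
    unfolding open_fun_def by auto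
  have "\<exists>c. f \<in> rat_box c \<and> rat_box c \<subseteq> {g. \<forall>i\<in>J. g i \<in> X i}" if "finite J" for J
    using that
  proof (induction J)
    case empty
    show ?case
      by (rule exI[of _ "[]"]) simp
  next
    case (insert i J)
    then obtain c where c: "f \<in> rat_box c" "rat_box c \<subseteq> {g. \<forall>i\<in>J. g i \<in> X i}"
      by blast
    have "f i \<in> X i"
      using X(1) by auto
    then obtain e where e: "e > 0" "ball (f i) e \<subseteq> X i"
      using X(2)[of i] open_contains_ball by blast
    obtain a where a: "f i - e < real_of_rat a" "real_of_rat a < f i"
      using of_rat_dense[of "f i - e" "f i"] e by auto
    obtain b where b: "f i < real_of_rat b" "real_of_rat b < f i + e"
      using of_rat_dense[of "f i" "f i + e"] e by auto
    have "g i \<in> X i" if "g \<in> rat_box ((i, a, b) # c)" for g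
      using that a b e(2) by (auto simp: rat_box_Cons dist_real_def subset_iff)
    then have "rat_box ((i, a, b) # c) \<subseteq> {g. \<forall>j\<in>insert i J. g j \<in> X j}"
      using c(2) by (auto simp: rat_box_Cons)
    moreover have "f \<in> rat_box ((i, a, b) # c)"
      using a b c(1) by (auto simp: rat_box_Cons)
    ultimately show ?case
      by blast
  qed
  from this[OF X(3)] obtain c where c: "f \<in> rat_box c" "rat_box c \<subseteq> {g. \<forall>i\<in>{i. X i \<noteq> UNIV}. g i \<in> X i}"
    by blast
  moreover have "{g. \<forall>i\<in>{i. X i \<noteq> UNIV}. g i \<in> X i} \<subseteq> PiE UNIV X"
    by (auto simp: PiE_def Pi_def)
  ultimately have "rat_box c \<subseteq> U"
    using X(4) by blast
  with c(1) show thesis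
    by (rule that)
qed

lemma rat_box_separate:
  assumes "f i \<noteq> g i"
  obtains c d where "f \<in> rat_box c" "g \<in> rat_box d" "supp c = {i}" "supp d = {i}" "rat_box c \<inter> rat_box d = {}"
proof -
  have *: "\<exists>c d. u \<in> rat_box c \<and> v \<in> rat_box d \<and> supp c = {i} \<and> supp d = {i} \<and> rat_box c \<inter> rat_box d = {}"
    if lt: "u i < v i" for u v :: "'a \<Rightarrow> real"
  proof -
    obtain q where q: "u i < real_of_rat q" "real_of_rat q < v i"
      using of_rat_dense[OF lt] by blast
    obtain a where a: "u i - 1 < real_of_rat a" "real_of_rat a < u i"
      using of_rat_dense[of "u i - 1" "u i"] by auto
    obtain b where b: "v i < real_of_rat b" "real_of_rat b < v i + 1"
      using of_rat_dense[of "v i" "v i + 1"] by auto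
    show ?thesis
      by (rule exI[of _ "[(i, a, q)]"], rule exI[of _ "[(i, q, b)]"])
         (use q a b in \<open>auto simp: rat_box_def supp_def\<close>)
  qed
  show thesis
  proof (cases "f i < g i")
    case True
    then show thesis
      using *[of f g] that by blast
  next
    case False
    then show thesis
      using *[of g f] that assms by (metis Int_commute linorder_cases)
  qed
qed

lemma countable_codes:
  assumes "countable S"
  shows "countable {c :: 'i code. supp c \<subseteq> S}"
proof (rule countable_subset)
  show "{c :: 'i code. supp c \<subseteq> S} \<subseteq> lists (S \<times> UNIV)"
    by (force simp: supp_def)
  show "countable (lists (S \<times> (UNIV :: (rat \<times> rat) set)))"
    using assms by (intro countable_lists countable_SIGMA) auto
qed

lemma code_sequences_lepoll_real: "(UNIV :: (nat \<Rightarrow> real code) set) \<lesssim> (UNIV :: real set)"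
  by (intro sequences_lepoll_real lists_lepoll_real pairs_lepoll_real countable_type_lepoll_real lepoll_refl)

lemma compact_product:
  assumes "\<And>i. compact (K i)"
  shows "compact {f. \<forall>i. f i \<in> K i}"
proof -
  have "compactin (product_topology (\<lambda>_. euclidean) UNIV) (PiE UNIV K)"
    using assms by (simp add: compactin_PiE)
  moreover have "PiE UNIV K = {f. \<forall>i. f i \<in> K i}"
    by (auto simp: PiE_def Pi_def)
  ultimately show ?thesis
    by (simp add: euclidean_product_topology)
qed

lemma compact_imp_closed_fun:
  fixes F :: "('i \<Rightarrow> real) set"
  assumes "compact F"
  shows "closed F"
proof -
  have "Hausdorff_space (euclidean :: ('i \<Rightarrow> real) topology)"
    by (simp add: euclidean_product_topology[symmetric] Hausdorff_space_product_topology)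
  then show ?thesis
    using assms compactin_imp_closedin[of euclidean F] by simp
qed

lemma compact_cube: "compact cube"
  unfolding cube_def by (rule compact_product) simp

lemma closed_cube: "closed cube"
  by (rule compact_imp_closed_fun) (rule compact_cube)

section \<open>Cylinders, their hulls, and zero sets of the cube\<close>

definition cylinder :: "'i set \<Rightarrow> ('i \<Rightarrow> real) set \<Rightarrow> bool" where
  "cylinder S F \<longleftrightarrow> F \<subseteq> cube \<and> (\<forall>f\<in>F. \<forall>g\<in>cube. (\<forall>i\<in>S. f i = g i) \<longrightarrow> g \<in> F)"

text \<open>The preimage in the cube of the projection of \<open>F\<close> to the coordinates in
  \<open>S\<close>; it stands in for that projection without a change of type.\<close>

definition cyl_hull :: "'i set \<Rightarrow> ('i \<Rightarrow> real) set \<Rightarrow> ('i \<Rightarrow> real) set" where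
  "cyl_hull S F = {f \<in> cube. \<exists>g\<in>F. \<forall>i\<in>S. f i = g i}"

text \<open>A box is a cozero set, so these are zero sets of continuous functions on the cube; over
  \<open>real\<close> their codes number at most continuum.\<close>

definition zero_set :: "(nat \<Rightarrow> 'i code) \<Rightarrow> ('i \<Rightarrow> real) set" where
  "zero_set b = cube - (\<Union>n. rat_box (b n))"

definition supps :: "(nat \<Rightarrow> 'i code) \<Rightarrow> 'i set" where
  "supps b = (\<Union>n. supp (b n))"

lemma countable_supps: "countable (supps b)"
  unfolding supps_def by (intro countable_UN) (auto simp: finite_supp countable_finite)

lemma closed_zero_set: "closed (zero_set b)"
  unfolding zero_set_def by (rule closed_Diff[OF closed_cube]) (simp add: open_UN open_rat_box)

lemma cylinder_zero_set:
  assumes "supps b \<subseteq> S"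
  shows "cylinder S (zero_set b)"
proof -
  have "g \<notin> rat_box (b n)" if "f \<notin> rat_box (b n)" "\<forall>i\<in>S. f i = g i" for f g n
    using that assms rat_box_cong[of g "b n" f] by (force simp: supps_def)
  then show ?thesis
    unfolding cylinder_def zero_set_def by blast
qed

lemma cylinder_cyl_hull: "cylinder S (cyl_hull S F)"
  by (auto simp: cylinder_def cyl_hull_def)

lemma cyl_hull_mono: "F \<subseteq> G \<Longrightarrow> cyl_hull S F \<subseteq> cyl_hull S G"
  by (auto simp: cyl_hull_def)

lemma cyl_hull_antimono: "S \<subseteq> T \<Longrightarrow> cyl_hull T F \<subseteq> cyl_hull S F"
  unfolding cyl_hull_def by blast

lemma subset_cyl_hull: "F \<subseteq> cube \<Longrightarrow> F \<subseteq> cyl_hull S F"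
  by (auto simp: cyl_hull_def)

text \<open>Overwriting the coordinates outside \<open>S\<close> by 0 is continuous, and the hull is
  the preimage of the compact image of \<open>F\<close> under this map.\<close>

lemma closed_cyl_hull:
  assumes "compact F"
  shows "closed (cyl_hull S F)"
proof -
  define r :: "('a \<Rightarrow> real) \<Rightarrow> 'a \<Rightarrow> real" where "r = (\<lambda>f i. if i \<in> S then f i else 0)"
  have cont: "continuous_on UNIV r"
    unfolding r_def
  proof (rule continuous_on_coordinatewise_then_product)
    fix i
    show "continuous_on UNIV (\<lambda>f :: 'a \<Rightarrow> real. if i \<in> S then f i else 0)"
      by (cases "i \<in> S") (auto intro: continuous_on_product_coordinates)
  qed
  have "compact (r ` F)"
    using assms cont by (intro compact_continuous_image) (auto intro: continuous_on_subset)
  then have "closed (r -` (r ` F))"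
    by (intro closed_vimage compact_imp_closed_fun cont)
  moreover have "cyl_hull S F = cube \<inter> r -` (r ` F)"
    by (fastforce simp: cyl_hull_def r_def fun_eq_iff image_iff split: if_splits)
  ultimately show ?thesis
    using closed_Int[OF closed_cube] by metis
qed

lemma cylinder_avoid:
  assumes F: "closed F" "cylinder S F" and f: "f \<in> cube" "f \<notin> F"
  obtains c where "supp c \<subseteq> S" "f \<in> rat_box c" "rat_box c \<inter> F = {}"
proof -
  obtain d where d: "f \<in> rat_box d" "rat_box d \<subseteq> - F"
    using rat_box_basis[of "- F" f] F(1) f(2) by auto
  define c where "c = filter (\<lambda>p. fst p \<in> S) d"
  have "g \<notin> F" if "g \<in> rat_box c" for g
  proof
    assume gF: "g \<in> F"
    define h where "h = (\<lambda>i. if i \<in> S then g i else f i)"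
    have "h \<in> rat_box d"
      using that d(1) by (fastforce simp: rat_box_def h_def c_def)
    moreover have "h \<in> F"
      using F(2) gF f(1) unfolding cylinder_def by (auto simp: h_def cube_def)
    ultimately show False
      using d(2) by auto
  qed
  moreover have "f \<in> rat_box c" "supp c \<subseteq> S"
    using d(1) by (auto simp: rat_box_def supp_def c_def)
  ultimately show thesis
    using that by blast
qed

lemma closed_cylinder_zero_set:
  assumes "closed F" "cylinder S F" "countable S"
  obtains b where "F = zero_set b"
proof -
  define W where "W = insert [(undefined, 0, 0)] {c. supp c \<subseteq> S \<and> rat_box c \<inter> F = {}}"
  have W: "countable W" "W \<noteq> {}"
    unfolding W_def using countable_codes[OF assms(3)]
    by (auto intro: countable_subset[of _ "{c. supp c \<subseteq> S}"])
  have "F = zero_set (from_nat_into W)"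
  proof -
    have *: "(\<Union>n. rat_box (from_nat_into W n)) = (\<Union>c\<in>W. rat_box c)"
      using range_from_nat_into[OF W(2,1)] by (metis image_image)
    have "F \<subseteq> cube - (\<Union>c\<in>W. rat_box c)"
      using assms(2) by (auto simp: W_def cylinder_def empty_rat_box_code)
    moreover have "cube - (\<Union>c\<in>W. rat_box c) \<subseteq> F"
    proof
      fix f assume f: "f \<in> cube - (\<Union>c\<in>W. rat_box c)"
      show "f \<in> F"
      proof (rule ccontr)
        assume "f \<notin> F"
        then obtain c where "supp c \<subseteq> S" "f \<in> rat_box c" "rat_box c \<inter> F = {}"
          using cylinder_avoid assms f by blast
        then show False
          using f by (auto simp: W_def)
      qed
    qed
    ultimately show ?thesis
      unfolding zero_set_def * by blast
  qed
  then show thesis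
    using that by blast
qed

section \<open>Michael's construction\<close>

text \<open>The test spaces may live on the type of the cube because Michael's construction
  retopologises a set of its points.\<close>

definition Lindelof_factor :: "('i \<Rightarrow> real) set \<Rightarrow> bool" where
  "Lindelof_factor Z \<longleftrightarrow>
     (\<forall>Y :: ('i \<Rightarrow> real) topology. Lindelof_space Y \<longrightarrow> Lindelof_space (prod_topology (top_of_set Z) Y))"

text \<open>Michael's construction: the points of \<open>A\<close> are isolated, and a point \<open>y\<close> of \<open>L\<close> sees only
  its coordinates in \<open>S y\<close>. The diagonal of \<open>A\<close> is then closed and discrete in the product of
  \<open>Z\<close> with this space, so the space cannot be Lindelof.\<close>

lemma no_Lindelof_extension:
  fixes Z :: "('i \<Rightarrow> real) set"
  assumes Z: "Lindelof_factor Z" and A: "A \<subseteq> Z" "uncountable A"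
    and sep: "\<And>y z. y \<in> L \<Longrightarrow> z \<in> Z \<Longrightarrow> \<exists>i\<in>S y. y i \<noteq> z i"
    and Lindelof: "\<And>\<W>. (\<And>y. y \<in> L \<Longrightarrow> \<exists>c\<in>\<W>. y \<in> rat_box c \<and> supp c \<subseteq> S y) \<Longrightarrow>
       \<exists>\<V>\<subseteq>\<W>. countable \<V> \<and> (\<forall>y\<in>L. \<exists>c\<in>\<V>. y \<in> rat_box c \<and> supp c \<subseteq> S y) \<and>
         countable (A - (\<Union>c\<in>\<V>. rat_box c))"
  shows False
proof -
  \<comment> \<open>The trace of a box on the new space: all its points from \<open>A\<close>, but
    only those points of \<open>L\<close> that are allowed to see every coordinate in the
    support.\<close>
  define N where "N = (\<lambda>c. {y \<in> L. y \<in> rat_box c \<and> supp c \<subseteq> S y} \<union> A \<inter> rat_box c)"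
  have disj: "L \<inter> A = {}"
    using sep A(1) by fastforce
  define op where "op = (\<lambda>V. V \<subseteq> L \<union> A \<and>
    (\<forall>y\<in>V \<inter> L. \<exists>c. y \<in> rat_box c \<and> supp c \<subseteq> S y \<and> N c \<subseteq> V))"
  have N_append: "N (c @ d) = N c \<inter> N d" for c d
    using disj by (auto simp: N_def)
  have "istopology op"
    unfolding istopology_def
  proof (intro conjI allI impI)
    fix V W assume VW: "op V" "op W"
    have "\<exists>c. y \<in> rat_box c \<and> supp c \<subseteq> S y \<and> N c \<subseteq> V \<inter> W" if y: "y \<in> V \<inter> W \<inter> L" for y
    proof -
      obtain c d where "y \<in> rat_box c" "supp c \<subseteq> S y" "N c \<subseteq> V"
        "y \<in> rat_box d" "supp d \<subseteq> S y" "N d \<subseteq> W"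
        using y VW unfolding op_def by (meson IntD1 IntD2 IntI)
      then show ?thesis
        by (intro exI[of _ "c @ d"]) (auto simp: N_append)
    qed
    then show "op (V \<inter> W)"
      using VW unfolding op_def by blast
  next
    fix \<K> assume "\<forall>K\<in>\<K>. op K"
    then show "op (\<Union> \<K>)"
      unfolding op_def by (meson Int_iff UnionE Union_upper Sup_least order_trans IntI)
  qed
  define Y where "Y = topology op"
  have openY: "openin Y = op"
    unfolding Y_def by (rule topology_inverse'[OF \<open>istopology op\<close>])
  have "op (L \<union> A)"
    unfolding op_def
  proof (intro conjI ballI)
    fix y assume "y \<in> (L \<union> A) \<inter> L"
    show "\<exists>c. y \<in> rat_box c \<and> supp c \<subseteq> S y \<and> N c \<subseteq> L \<union> A"
      by (rule exI[of _ "[]"]) (auto simp: N_def)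
  qed simp
  then have topY: "topspace Y = L \<union> A"
    using openin_subset[of Y "L \<union> A"] openin_topspace[of Y] by (auto simp: openY op_def)
  have openN: "openin Y (N c)" for c
    unfolding openY op_def N_def using disj by blast
  have open_single: "openin Y {a}" if "a \<in> A" for a
    using that disj by (auto simp: openY op_def)
  have "Lindelof_space Y"
    unfolding Lindelof_space_alt
  proof (intro allI impI)
    fix \<U> assume U: "(\<forall>U\<in>\<U>. openin Y U) \<and> topspace Y \<subseteq> \<Union> \<U>"
    \<comment> \<open>An arbitrary open cover is replaced by the codes whose traces refine it; the
      countably many points of \<open>A\<close> missed by the selected boxes are then covered one by
      one.\<close>
    define \<W> where "\<W> = {c. \<exists>U\<in>\<U>. N c \<subseteq> U}"
    have "\<exists>c\<in>\<W>. y \<in> rat_box c \<and> supp c \<subseteq> S y" if y: "y \<in> L" for y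
    proof -
      obtain U where "U \<in> \<U>" "y \<in> U"
        using U y topY by blast
      then show ?thesis
        using U y unfolding openY op_def \<W>_def by blast
    qed
    then obtain \<V> where V: "\<V> \<subseteq> \<W>" "countable \<V>" "\<forall>y\<in>L. \<exists>c\<in>\<V>. y \<in> rat_box c \<and> supp c \<subseteq> S y"
      "countable (A - (\<Union>c\<in>\<V>. rat_box c))"
      using Lindelof[of \<W>] by auto
    have "\<forall>c\<in>\<V>. \<exists>U. U \<in> \<U> \<and> N c \<subseteq> U"
      using V(1) by (auto simp: \<W>_def)
    then obtain u where u: "\<forall>c\<in>\<V>. u c \<in> \<U> \<and> N c \<subseteq> u c"
      by metis
    have "\<forall>a\<in>A. \<exists>U. U \<in> \<U> \<and> a \<in> U"
      using U topY by blast
    then obtain v where v: "\<forall>a\<in>A. v a \<in> \<U> \<and> a \<in> v a"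
      by metis
    let ?V = "u ` \<V> \<union> v ` (A - (\<Union>c\<in>\<V>. rat_box c))"
    have "x \<in> \<Union> ?V" if x: "x \<in> L \<union> A" for x
    proof (cases "\<exists>c\<in>\<V>. x \<in> N c")
      case True
      then show ?thesis
        using u by blast
    next
      case False
      have "x \<in> A"
        using False V(3) x unfolding N_def by blast
      moreover have "x \<notin> (\<Union>c\<in>\<V>. rat_box c)"
        using False \<open>x \<in> A\<close> unfolding N_def by blast
      ultimately show ?thesis
        using v by blast
    qed
    moreover have "countable ?V" "?V \<subseteq> \<U>"
      using V(2,4) u v by auto
    ultimately show "\<exists>\<V>. countable \<V> \<and> \<V> \<subseteq> \<U> \<and> topspace Y \<subseteq> \<Union> \<V>"
      unfolding topY by (intro exI[of _ ?V]) blast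
  qed
  then have lin: "Lindelof_space (prod_topology (top_of_set Z) Y)"
    using Z by (simp add: Lindelof_factor_def)
  \<comment> \<open>The diagonal point \<open>(a, a)\<close> lies in no rectangle, as the two boxes
    are disjoint, so only the strip \<open>Z \<times> {a}\<close> covers it and no strip can be
    omitted.\<close>
  define \<C> where "\<C> = (\<lambda>a. Z \<times> {a}) ` A \<union> {(Z \<inter> rat_box d) \<times> N c |c d. rat_box c \<inter> rat_box d = {}}"
  have open_trace: "openin (top_of_set Z) (Z \<inter> rat_box d)" for d
    by (rule openin_open_Int[OF open_rat_box])
  have "openin (prod_topology (top_of_set Z) Y) U" if "U \<in> \<C>" for U
    using that openN open_single open_trace unfolding \<C>_def
    by (auto simp: openin_prod_Times_iff)
  moreover have "topspace (prod_topology (top_of_set Z) Y) \<subseteq> \<Union> \<C>"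
  proof
    fix p assume "p \<in> topspace (prod_topology (top_of_set Z) Y)"
    then obtain z y where p: "p = (z, y)" "z \<in> Z" "y \<in> L \<union> A"
      by (auto simp: topY)
    show "p \<in> \<Union> \<C>"
    proof (cases "y \<in> A")
      case True
      then show ?thesis
        using p by (auto simp: \<C>_def)
    next
      case False
      then obtain i where i: "i \<in> S y" "y i \<noteq> z i"
        using p sep by blast
      obtain c d where "y \<in> rat_box c" "z \<in> rat_box d" "supp c = {i}" "rat_box c \<inter> rat_box d = {}"
        using rat_box_separate[of y i z] i(2) by metis
      then have "p \<in> (Z \<inter> rat_box d) \<times> N c" "(Z \<inter> rat_box d) \<times> N c \<in> \<C>"
        using p False i(1) unfolding \<C>_def N_def by auto
      then show ?thesis
        by blast
    qed
  qed
  ultimately obtain \<D> where D: "countable \<D>" "\<D> \<subseteq> \<C>"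
    "topspace (prod_topology (top_of_set Z) Y) \<subseteq> \<Union> \<D>"
    using lin unfolding Lindelof_space_alt by meson
  have "Z \<times> {a} \<in> \<D>" if a: "a \<in> A" for a
  proof -
    have "(a, a) \<in> topspace (prod_topology (top_of_set Z) Y)"
      using a A(1) by (auto simp: topY)
    then obtain U where U: "U \<in> \<D>" "(a, a) \<in> U"
      using D(3) by blast
    have "U \<notin> {(Z \<inter> rat_box d) \<times> N c |c d. rat_box c \<inter> rat_box d = {}}"
      using U(2) a disj unfolding N_def by blast
    then obtain b where "U = Z \<times> {b}"
      using U(1) D(2) unfolding \<C>_def by blast
    then show ?thesis
      using U by simp
  qed
  then have "countable ((\<lambda>a. Z \<times> {a}) ` A)"
    using D(1) by (blast intro: countable_subset)
  moreover have "inj_on (\<lambda>a. Z \<times> {a}) A"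
    using A(1) by (auto simp: inj_on_def times_eq_iff)
  ultimately show False
    using A(2) countable_image_inj_on by blast
qed

lemma compact_zero_set: "compact (zero_set b)"
  unfolding zero_set_def using open_rat_box by (intro compact_diff compact_cube) auto

text \<open>The witness \<open>b0\<close> replaces the codes that violate \<open>P\<close>, so that
  the range is exact.\<close>

lemma enumerate_code_sequences:
  assumes "P b0"
  obtains b :: "real \<Rightarrow> nat \<Rightarrow> real code" where "range b = {c. P c}"
proof -
  obtain s :: "real \<Rightarrow> nat \<Rightarrow> real code" where s: "UNIV \<subseteq> range s"
    using code_sequences_lepoll_real unfolding lepoll_iff by blast
  have "range (\<lambda>r. if P (s r) then s r else b0) = {c. P c}"
    using assms s by (auto simp: image_iff subset_iff)
  then show thesis
    using that by blast
qed

text \<open>For countable \<open>S\<close> there are only countably many codes supported in \<open>S\<close>, so in Michael's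
  construction over the complement of \<open>cyl_hull S Z\<close> only the isolated points matter.\<close>

lemma cyl_hull_countable_Union_closed:
  fixes Z :: "(real \<Rightarrow> real) set"
  assumes lt: "omega1_order lt" and Z: "Lindelof_factor Z" "Z \<subseteq> cube" and S: "countable S"
  obtains \<Q> where "countable \<Q>" "\<And>F. F \<in> \<Q> \<Longrightarrow> closed F \<and> cylinder S F" "cyl_hull S Z = \<Union> \<Q>"
proof -
  let ?H = "cyl_hull S Z"
  \<comment> \<open>The empty code names the whole space, so this zero set is empty and the
    enumeration has a starting value.\<close>
  have "zero_set (\<lambda>_. []) \<subseteq> ?H"
    by (simp add: zero_set_def)
  then obtain b :: "real \<Rightarrow> nat \<Rightarrow> real code" where b: "range b = {c. zero_set c \<subseteq> ?H}"
    by (rule enumerate_code_sequences[where P = "\<lambda>c. zero_set c \<subseteq> ?H"])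
  have bH: "zero_set (b r) \<subseteq> ?H" for r
    using b by auto
  show thesis
  \<comment> \<open>The claim says that the projection of \<open>Z\<close> to \<open>S\<close> is
    \<sigma>-compact. Either countably many zero sets inside the hull already cover
    \<open>Z\<close>, or uncountably many points can be picked that meet each of them in a countable
    set.\<close>
  proof (cases "\<exists>B. countable B \<and> Z \<subseteq> (\<Union>r\<in>B. zero_set (b r))")
    case True
    then obtain B where B: "countable B" "Z \<subseteq> (\<Union>r\<in>B. zero_set (b r))"
      by blast
    let ?Q = "(\<lambda>r. cyl_hull S (zero_set (b r))) ` B"
    have "?H \<subseteq> \<Union> ?Q"
      using B(2) unfolding cyl_hull_def by blast
    moreover have "\<Union> ?Q \<subseteq> ?H"
      using bH unfolding cyl_hull_def by fastforce
    moreover have "closed F \<and> cylinder S F" if "F \<in> ?Q" for F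
      using that closed_cyl_hull[OF compact_zero_set] cylinder_cyl_hull by blast
    ultimately show thesis
      using that[of ?Q] B(1) by blast
  next
    case False
    have mem: "\<exists>r. F \<subseteq> zero_set (b r)" if F: "closed F" "cylinder S F" "F \<subseteq> ?H" for F
    proof -
      obtain c where c: "F = zero_set c"
        by (rule closed_cylinder_zero_set[OF F(1,2) S])
      then have "c \<in> range b"
        using b F(3) by simp
      then show ?thesis
        using c by auto
    qed
    have cover: "Z \<subseteq> (\<Union>r. zero_set (b r))"
    proof
      fix z assume z: "z \<in> Z"
      have "closed (cyl_hull S {z})"
        by (rule closed_cyl_hull) simp
      then obtain r where "cyl_hull S {z} \<subseteq> zero_set (b r)"
        using mem[of "cyl_hull S {z}"] cylinder_cyl_hull cyl_hull_mono[of "{z}" Z S] z by auto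
      then show "z \<in> (\<Union>r. zero_set (b r))"
        using subset_cyl_hull[of "{z}" S] z Z(2) by auto
    qed
    have none: "\<not> Z \<subseteq> (\<Union>r\<in>B. zero_set (b r))" if "countable B" for B
      using False that by blast
    obtain A where A: "A \<subseteq> Z" "uncountable A" "\<And>r. countable (A \<inter> zero_set (b r))"
      by (rule select_uncountable[OF lt cover none]) auto
    have False
    proof (rule no_Lindelof_extension[OF Z(1) A(1,2), where S = "\<lambda>_. S" and L = "cube - ?H"])
      show "\<exists>i\<in>S. y i \<noteq> z i" if "y \<in> cube - ?H" "z \<in> Z" for y z
        using that by (auto simp: cyl_hull_def)
    next
      fix \<W> assume W: "\<And>y. y \<in> cube - ?H \<Longrightarrow> \<exists>c\<in>\<W>. y \<in> rat_box c \<and> supp c \<subseteq> S"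
      let ?V = "{c\<in>\<W>. supp c \<subseteq> S}"
      have V: "countable ?V"
        by (rule countable_subset[OF _ countable_codes[OF S]]) blast
      \<comment> \<open>What the boxes leave of the cube is a closed cylinder inside the hull, hence
        lies in one of the enumerated zero sets, which contains only countably many points of
        \<open>A\<close>.\<close>
      let ?F = "cube - (\<Union>c\<in>?V. rat_box c)"
      have "closed ?F"
        using closed_cube open_rat_box by (intro closed_Diff) auto
      moreover have "cylinder S ?F"
        unfolding cylinder_def
      proof (intro conjI ballI impI)
        fix f g assume fg: "f \<in> ?F" "g \<in> cube" "\<forall>i\<in>S. f i = g i"
        have "g \<notin> rat_box c" if "c \<in> ?V" for c
        proof
          assume "g \<in> rat_box c"
          moreover have "g i = f i" if "i \<in> supp c" for i
            using that \<open>c \<in> ?V\<close> fg(3) by auto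
          ultimately have "f \<in> rat_box c"
            by (rule rat_box_cong)
          then show False
            using that fg(1) by blast
        qed
        then show "g \<in> ?F"
          using fg by blast
      qed blast
      moreover have "?F \<subseteq> ?H"
        using W by blast
      ultimately obtain r where r: "?F \<subseteq> zero_set (b r)"
        using mem by blast
      have "A - (\<Union>c\<in>?V. rat_box c) \<subseteq> A \<inter> zero_set (b r)"
        using r A(1) Z(2) by blast
      then have "countable (A - (\<Union>c\<in>?V. rat_box c))"
        using A(3) countable_subset by blast
      moreover have "\<forall>y\<in>cube - ?H. \<exists>c\<in>?V. y \<in> rat_box c \<and> supp c \<subseteq> S"
        using W by blast
      ultimately show "\<exists>\<V>\<subseteq>\<W>. countable \<V> \<and> (\<forall>y\<in>cube - ?H. \<exists>c\<in>\<V>. y \<in> rat_box c \<and> supp c \<subseteq> S) \<and>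
          countable (A - (\<Union>c\<in>\<V>. rat_box c))"
        using V by (intro exI[of _ ?V]) blast
    qed
    then show thesis ..
  qed
qed

lemma Lindelof_factor_imp_Lindelof:
  assumes "Lindelof_factor Z"
  shows "Lindelof_space (top_of_set Z)"
proof -
  have "Lindelof_space (top_of_set {undefined :: 'a \<Rightarrow> real})"
    by (intro compact_imp_Lindelof_space) (simp add: compact_space_subtopology)
  then have "Lindelof_space (prod_topology (top_of_set Z) (top_of_set {undefined :: 'a \<Rightarrow> real}))"
    using assms unfolding Lindelof_factor_def by blast
  then show ?thesis
    by (rule Lindelof_space_continuous_map_image[OF _ continuous_map_fst]) auto
qed

text \<open>The sets of functions that differ from \<open>y\<close> at a fixed coordinate cover
  \<open>Z\<close>; the coordinates of a countable subcover form \<open>J\<close>.\<close>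

lemma outside_countable_cyl_hull:
  assumes Z: "Lindelof_space (top_of_set Z)" and y: "y \<notin> Z"
  obtains J where "countable J" "y \<notin> cyl_hull J Z"
proof -
  define U where "U = (\<lambda>i. Z \<inter> {f. f i \<noteq> y i})"
  have "openin (top_of_set Z) (U i)" for i
    unfolding U_def
    by (intro openin_open_Int open_Collect_neq continuous_coordinate continuous_on_const)
  moreover have "topspace (top_of_set Z) \<subseteq> \<Union> (range U)"
  proof
    fix z assume "z \<in> topspace (top_of_set Z)"
    then have "z \<in> Z" "z \<noteq> y"
      using y by auto
    then show "z \<in> \<Union> (range U)"
      by (auto simp: U_def fun_eq_iff)
  qed
  ultimately obtain \<V> where V: "countable \<V>" "\<V> \<subseteq> range U" "Z \<subseteq> \<Union> \<V>"
    using Z unfolding Lindelof_space_alt by (metis imageE topspace_euclidean_subtopology)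
  then obtain J where J: "countable J" "\<V> = U ` J"
    by (metis countable_subset_image)
  have "y \<notin> cyl_hull J Z"
    using V(3) unfolding J U_def cyl_hull_def by fastforce
  then show thesis
    using that J(1) by blast
qed

text \<open>Compactness inserts a coded set between \<open>Q\<close> and an arbitrary
  \<open>G\<^sub>\<delta>\<close> set: for each of the countably many open sets, finitely many boxes
  that miss \<open>Q\<close> cover its complement in the cube.\<close>

lemma zero_set_between:
  assumes Q: "compact Q" "Q \<subseteq> cube" and H: "gdelta H" "Q \<subseteq> H"
  obtains b where "Q \<subseteq> zero_set b" "zero_set b \<subseteq> H"
proof -
  obtain V :: "nat \<Rightarrow> _" where V: "\<And>n. open (V n)" "H = \<Inter> (range V)"
    using H(1) by (auto elim: gdelta.cases)
  have "\<exists>W. finite W \<and> (\<forall>c\<in>W. rat_box c \<inter> Q = {}) \<and> cube - V n \<subseteq> (\<Union>c\<in>W. rat_box c)" for n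
  proof -
    have "compact (cube - V n)"
      using compact_cube V(1) by (intro compact_diff)
    moreover have "cube - V n \<subseteq> (\<Union>c\<in>{c. rat_box c \<inter> Q = {}}. rat_box c)"
    proof
      fix f assume "f \<in> cube - V n"
      then have "f \<in> - Q"
        using H(2) V(2) by auto
      then obtain c where "f \<in> rat_box c" "rat_box c \<subseteq> - Q"
        using rat_box_basis[of "- Q" f] compact_imp_closed_fun[OF Q(1)] by (auto simp: open_Compl)
      then show "f \<in> (\<Union>c\<in>{c. rat_box c \<inter> Q = {}}. rat_box c)"
        by blast
    qed
    ultimately obtain W where "W \<subseteq> {c. rat_box c \<inter> Q = {}}" "finite W" "cube - V n \<subseteq> (\<Union>c\<in>W. rat_box c)"
      using compactE_image[where f = rat_box and C = "{c. rat_box c \<inter> Q = {}}"] open_rat_box by metis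
    then show ?thesis
      by blast
  qed
  then obtain W where W: "\<And>n. finite (W n)" "\<And>n c. c \<in> W n \<Longrightarrow> rat_box c \<inter> Q = {}"
    "\<And>n. cube - V n \<subseteq> (\<Union>c\<in>W n. rat_box c)"
    by metis
  define W' where "W' = insert [(undefined, 0, 0)] (\<Union>n. W n)"
  have W': "countable W'" "W' \<noteq> {}"
    using W(1) by (auto simp: W'_def countable_finite)
  have "(\<Union>n. rat_box (from_nat_into W' n)) = (\<Union>c\<in>W'. rat_box c)"
    using range_from_nat_into[OF W'(2,1)] by (metis image_image)
  then have z: "zero_set (from_nat_into W') = cube - (\<Union>c\<in>W'. rat_box c)"
    by (simp add: zero_set_def)
  have "Q \<subseteq> cube - (\<Union>c\<in>W'. rat_box c)"
    using Q(2) W(2) by (auto simp: W'_def empty_rat_box_code)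
  moreover have "cube - (\<Union>c\<in>W'. rat_box c) \<subseteq> H"
    using W(3) unfolding V(2) W'_def by blast
  ultimately show thesis
    using that[of "from_nat_into W'"] z by simp
qed

section \<open>Alster's theorem\<close>

text \<open>The level \<open>d\<close> is the least strict upper bound of the sequence, so whatever
  happens below \<open>d\<close> already happens below some \<open>s n\<close>.\<close>

lemma omega1_order_closing_off:
  assumes lt: "omega1_order lt" and "\<And>d. \<exists>e. lt d e \<and> R d e"
  shows "\<exists>s d. (\<forall>n. R (s n) (s (Suc n))) \<and> (\<forall>n. lt (s n) (s (Suc n))) \<and> (\<forall>n. lt (s n) d) \<and>
    (\<forall>c. lt c d \<longrightarrow> (\<exists>n. lt c (s n)))"
proof -
  obtain nxt where nxt: "\<And>d. lt d (nxt d) \<and> R d (nxt d)"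
    using assms(2) by metis
  define s where "s = rec_nat 0 (\<lambda>_. nxt)"
  have s: "R (s n) (s (Suc n))" "lt (s n) (s (Suc n))" for n
    using nxt by (auto simp: s_def)
  obtain d0 where "\<And>b. b \<in> range s \<Longrightarrow> lt b d0"
    by (rule omega1_order_bound[OF lt, of "range s"]) auto
  then have "\<forall>n. lt (s n) d0"
    by blast
  then obtain d where d: "\<forall>n. lt (s n) d" "\<And>c. lt c d \<Longrightarrow> \<not> (\<forall>n. lt (s n) c)"
    by (rule omega1_order_least[OF lt]) blast
  have "\<exists>n. lt c (s n)" if c: "lt c d" for c
  proof -
    obtain n where "\<not> lt (s n) c"
      using d(2)[OF c] by blast
    then have "lt c (s n) \<or> c = s n"
      using lt unfolding omega1_order_def by blast
    then show ?thesis
      using s(2) by blast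
  qed
  then show ?thesis
    using s d(1) by (intro exI[of _ s] exI[of _ d]) simp
qed

text \<open>Points outside \<open>Z\<close> are ranked by the first level \<open>lam y\<close> at which their coordinates in
  \<open>S (lam y)\<close> separate them from \<open>Z\<close>. Michael's construction is applied to those points that are not
  yet covered by the sets \<open>G r\<close> below that level. If an open cover of them had no countable subcover
  modulo countably many \<open>G r\<close>, its locally non-thin kernel \<open>C\<close> would be non-empty; closing off yields a
  level \<open>d\<close> at which every relatively open piece of \<open>C\<close> contains a point of rank below \<open>d\<close>, and a Baire
  category argument in \<open>C\<close>, which works because the projection of \<open>Z\<close> to level \<open>d\<close> is
  \<open>\<sigma>\<close>-compact, produces a point of \<open>C\<close> that ought to have been covered.\<close>

theorem Lindelof_factor_imp_Alster:
  fixes Z :: "(real \<Rightarrow> real) set"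
  assumes lt: "omega1_order lt" and Z: "Lindelof_factor Z" "Z \<subseteq> cube"
    and H: "\<And>Q. compact Q \<Longrightarrow> Q \<subseteq> Z \<Longrightarrow> gdelta (H Q) \<and> Q \<subseteq> H Q"
  shows "\<exists>\<Q>. countable \<Q> \<and> (\<forall>Q\<in>\<Q>. compact Q \<and> Q \<subseteq> Z) \<and> Z \<subseteq> (\<Union>Q\<in>\<Q>. H Q)"
proof (rule ccontr)
  assume contra: "\<not> ?thesis"
  \<comment> \<open>The given assignment is replaced by zero sets squeezed below it; these can be
    indexed by reals as \<open>G r\<close>, while the values of \<open>H\<close> need not be of this
    simple form.\<close>
  define P where "P = (\<lambda>b. \<exists>Q. compact Q \<and> Q \<subseteq> Z \<and> Q \<subseteq> zero_set b \<and> zero_set b \<subseteq> H Q)"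
  have between: "\<exists>b. P b \<and> Q \<subseteq> zero_set b" if Q: "compact Q" "Q \<subseteq> Z" for Q
  proof -
    obtain b where "Q \<subseteq> zero_set b" "zero_set b \<subseteq> H Q"
      using H[OF Q] by (auto intro: zero_set_between[OF Q(1) order_trans[OF Q(2) Z(2)], of "H Q"])
    then show ?thesis
      using Q unfolding P_def by blast
  qed
  then obtain b0 where "P b0"
    using compact_empty by blast
  then obtain b :: "real \<Rightarrow> nat \<Rightarrow> real code" where b: "range b = {c. P c}"
    by (rule enumerate_code_sequences)
  define G where "G = (\<lambda>r. zero_set (b r))"
  have Pb: "P (b r)" for r
    using b by blast
  have compact_in_G: "\<exists>r. Q \<subseteq> G r" if Q: "compact Q" "Q \<subseteq> Z" for Q
  proof -
    obtain c where c: "P c" "Q \<subseteq> zero_set c"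
      using between[OF Q] by blast
    then have "c \<in> range b"
      using b by blast
    then show ?thesis
      using c(2) unfolding G_def by blast
  qed
  have none: "\<not> Z \<subseteq> (\<Union>r\<in>B. G r)" if "countable B" for B
  proof
    assume ZB: "Z \<subseteq> (\<Union>r\<in>B. G r)"
    obtain Q where Q: "\<And>r. compact (Q r) \<and> Q r \<subseteq> Z \<and> G r \<subseteq> H (Q r)"
      using Pb unfolding P_def G_def by metis
    have "countable (Q ` B)" "\<forall>K\<in>Q ` B. compact K \<and> K \<subseteq> Z" "Z \<subseteq> (\<Union>K\<in>Q ` B. H K)"
      using that Q ZB by (auto simp: subset_iff) metis
    then show False
      using contra by blast
  qed
  have cover: "Z \<subseteq> (\<Union>r. G r)"
  proof
    fix z assume "z \<in> Z"
    then obtain r where "{z} \<subseteq> G r"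
      using compact_in_G[of "{z}"] by auto
    then show "z \<in> (\<Union>r. G r)"
      by blast
  qed
  obtain A where A: "A \<subseteq> Z" "uncountable A" "\<And>r. countable (A \<inter> G r)"
    by (rule select_uncountable[OF lt cover none]) auto
  have lt_trans: "lt x z" if "lt x y" "lt y z" for x y z
    using that lt unfolding omega1_order_def transp_def by blast
  have lt_linear: "lt x y \<or> x = y \<or> lt y x" for x y
    using lt unfolding omega1_order_def by blast
  \<comment> \<open>Besides the indices below \<open>d\<close>, the level contains the supports of
    all earlier \<open>G r\<close>, which makes those sets cylinders over
    \<open>S d\<close>.\<close>
  define S where "S = (\<lambda>d. {i. lt i d} \<union> (\<Union>r\<in>{r. lt r d}. supps (b r)))"
  have S_countable: "countable (S d)" for d
    using lt countable_supps unfolding S_def omega1_order_def by (intro countable_Un countable_UN) auto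
  have S_mono: "S c \<subseteq> S d" if "lt c d" for c d
    using lt_trans that unfolding S_def by blast
  have G_cylinder: "cylinder (S d) (G r)" if "lt r d" for r d
    unfolding G_def by (rule cylinder_zero_set) (use that in \<open>auto simp: S_def\<close>)
  have G_closed: "closed (G r)" for r
    unfolding G_def by (rule closed_zero_set)
  have Lin: "Lindelof_space (top_of_set Z)"
    by (rule Lindelof_factor_imp_Lindelof[OF Z(1)])
  have "\<exists>m. y \<notin> cyl_hull (S m) Z \<and> (\<forall>c. lt c m \<longrightarrow> y \<in> cyl_hull (S c) Z)" if y: "y \<notin> Z" for y
  proof -
    obtain J where J: "countable J" "y \<notin> cyl_hull J Z"
      by (rule outside_countable_cyl_hull[OF Lin y])
    obtain d where "\<And>i. i \<in> J \<Longrightarrow> lt i d"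
      by (rule omega1_order_bound[OF lt J(1)]) blast
    then have "J \<subseteq> S d"
      unfolding S_def by blast
    then have "y \<notin> cyl_hull (S d) Z"
      using J(2) cyl_hull_antimono by blast
    then obtain m where "y \<notin> cyl_hull (S m) Z" "\<And>c. lt c m \<Longrightarrow> \<not> y \<notin> cyl_hull (S c) Z"
      by (rule omega1_order_least[OF lt]) blast
    then show ?thesis
      by blast
  qed
  then obtain lam where lam: "\<And>y. y \<notin> Z \<Longrightarrow> y \<notin> cyl_hull (S (lam y)) Z"
    and lam_least: "\<And>y c. y \<notin> Z \<Longrightarrow> lt c (lam y) \<Longrightarrow> y \<in> cyl_hull (S c) Z"
    by metis
  define L where "L = {y \<in> cube - Z. \<forall>r. lt r (lam y) \<longrightarrow> y \<notin> G r}"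
  show False
  proof (rule no_Lindelof_extension[OF Z(1) A(1,2), where S = "\<lambda>y. S (lam y)" and L = L])
    show "\<exists>i\<in>S (lam y). y i \<noteq> z i" if "y \<in> L" "z \<in> Z" for y z
      using that lam[of y] unfolding L_def cyl_hull_def by blast
  next
    fix \<W> assume W: "\<And>y. y \<in> L \<Longrightarrow> \<exists>c\<in>\<W>. y \<in> rat_box c \<and> supp c \<subseteq> S (lam y)"
    \<comment> \<open>The \<sigma>-ideal generated by the boxes of the cover and the sets
      \<open>G r\<close>; the goal is to put the whole cube into it.\<close>
    define thin where "thin = (\<lambda>D. \<exists>\<V> B. \<V> \<subseteq> \<W> \<and> countable \<V> \<and> countable B \<and>
      D \<subseteq> (\<Union>c\<in>\<V>. rat_box c) \<union> (\<Union>r\<in>B. G r))"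
    have thin_subset: "thin D" if "thin E" "D \<subseteq> E" for D E
      using that unfolding thin_def by (meson order_trans)
    have thin_G: "thin (G r)" for r
      unfolding thin_def by (rule exI[of _ "{}"], rule exI[of _ "{r}"]) auto
    have thin_box: "thin (rat_box c)" if "c \<in> \<W>" for c
      unfolding thin_def by (rule exI[of _ "{c}"], rule exI[of _ "{}"]) (use that in auto)
    have thin_Union: "thin (\<Union> \<D>)" if D: "countable \<D>" "\<And>D. D \<in> \<D> \<Longrightarrow> thin D" for \<D>
    proof -
      have "\<forall>D\<in>\<D>. \<exists>\<V> B. \<V> \<subseteq> \<W> \<and> countable \<V> \<and> countable B \<and>
        D \<subseteq> (\<Union>c\<in>\<V>. rat_box c) \<union> (\<Union>r\<in>B. G r)"
        using D(2) unfolding thin_def by blast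
      then obtain V B where VB: "\<And>D. D \<in> \<D> \<Longrightarrow> V D \<subseteq> \<W> \<and> countable (V D) \<and> countable (B D) \<and>
        D \<subseteq> (\<Union>c\<in>V D. rat_box c) \<union> (\<Union>r\<in>B D. G r)"
        by metis
      have "countable (\<Union> (V ` \<D>))"
        by (rule countable_UN[OF D(1)]) (simp add: VB)
      moreover have "countable (\<Union> (B ` \<D>))"
        by (rule countable_UN[OF D(1)]) (simp add: VB)
      moreover have "\<Union> (V ` \<D>) \<subseteq> \<W>"
        by (rule UN_least) (simp add: VB)
      moreover have "\<Union> \<D> \<subseteq> (\<Union>c\<in>\<Union> (V ` \<D>). rat_box c) \<union> (\<Union>r\<in>\<Union> (B ` \<D>). G r)"
      proof (rule Union_least)
        fix D assume D: "D \<in> \<D>"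
        have "D \<subseteq> (\<Union>c\<in>V D. rat_box c) \<union> (\<Union>r\<in>B D. G r)"
          using VB[OF D] by simp
        then show "D \<subseteq> (\<Union>c\<in>\<Union> (V ` \<D>). rat_box c) \<union> (\<Union>r\<in>\<Union> (B ` \<D>). G r)"
          by (rule order_trans) (intro Un_mono UN_mono UN_upper[OF D] order_refl)
      qed
      ultimately show ?thesis
        unfolding thin_def by (intro exI conjI)
    qed
    define T where "T = {c. thin (cube \<inter> rat_box c)}"
    define C where "C = cube - (\<Union>c\<in>T. rat_box c)"
    have C_closed: "closed C"
      unfolding C_def by (rule closed_Diff[OF closed_cube]) (simp add: open_UN open_rat_box)
    have C_compact: "compact C"
      unfolding C_def by (rule compact_diff[OF compact_cube]) (simp add: open_UN open_rat_box)
    have W_avoids_C: "rat_box c \<inter> C = {}" if "c \<in> \<W>" for c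
      using thin_subset[OF thin_box[OF that], of "cube \<inter> rat_box c"] by (auto simp: C_def T_def)
    have compact_thin: "thin D" if D: "compact D" "D \<subseteq> cube" "D \<inter> C = {}" for D
    proof -
      have "D \<subseteq> (\<Union>c\<in>T. rat_box c)"
        using D(2,3) unfolding C_def by blast
      then obtain F where F: "F \<subseteq> T" "finite F" "D \<subseteq> (\<Union>c\<in>F. rat_box c)"
        using compactE_image[OF D(1), of T rat_box] open_rat_box by metis
      have "thin (\<Union>c\<in>F. cube \<inter> rat_box c)"
        by (rule thin_Union) (use F in \<open>auto simp: T_def countable_finite\<close>)
      then show ?thesis
        by (rule thin_subset) (use F(3) D(2) in blast)
    qed
    have C_nowhere_in_G: "\<exists>y. y \<in> C \<inter> rat_box c - G r" if y: "y \<in> C \<inter> rat_box c" for y c r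
    proof (rule ccontr)
      assume "\<nexists>y. y \<in> C \<inter> rat_box c - G r"
      then have CG: "C \<inter> rat_box c \<subseteq> G r"
        by blast
      obtain e where e: "y \<in> rat_box e" "closed_rat_box e \<subseteq> rat_box c"
        using y by (auto elim: rat_box_shrink)
      \<comment> \<open>If a piece of \<open>C\<close> were inside \<open>G r\<close>, the smaller
        box would consist of points of \<open>G r\<close> and countably many compact sets outside
        \<open>G r\<close>. These miss \<open>C\<close>, hence are thin, and so the box would be
        thin although it meets \<open>C\<close>.\<close>
      define E where "E = {d. supp d \<subseteq> supps (b r) \<and> closed_rat_box d \<inter> G r = {}}"
      have "countable E"
        by (rule countable_subset[OF _ countable_codes[OF countable_supps[of "b r"]]])
           (auto simp: E_def)
      have "cube \<inter> rat_box e \<subseteq> \<Union> (insert (G r) ((\<lambda>d. cube \<inter> closed_rat_box e \<inter> closed_rat_box d) ` E))"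
      proof
        fix x assume x: "x \<in> cube \<inter> rat_box e"
        show "x \<in> \<Union> (insert (G r) ((\<lambda>d. cube \<inter> closed_rat_box e \<inter> closed_rat_box d) ` E))"
        proof (cases "x \<in> G r")
          case False
          then obtain n where "x \<in> rat_box (b r n)"
            using x unfolding G_def zero_set_def by blast
          then obtain d where "supp d = supp (b r n)" "x \<in> rat_box d" "closed_rat_box d \<subseteq> rat_box (b r n)"
            by (rule rat_box_shrink)
          then have "d \<in> E" "x \<in> closed_rat_box d" "x \<in> closed_rat_box e"
            using x rat_box_subset_closed_rat_box unfolding E_def G_def zero_set_def supps_def by blast+
          then show ?thesis
            using x by blast
        qed blast
      qed
      moreover have "thin (\<Union> (insert (G r) ((\<lambda>d. cube \<inter> closed_rat_box e \<inter> closed_rat_box d) ` E)))"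
      proof (rule thin_Union)
        show "countable (insert (G r) ((\<lambda>d. cube \<inter> closed_rat_box e \<inter> closed_rat_box d) ` E))"
          using \<open>countable E\<close> by simp
        fix D assume "D \<in> insert (G r) ((\<lambda>d. cube \<inter> closed_rat_box e \<inter> closed_rat_box d) ` E)"
        then consider "D = G r" | d where "d \<in> E" "D = cube \<inter> closed_rat_box e \<inter> closed_rat_box d"
          by blast
        then show "thin D"
        proof cases
          case 2
          have "compact D"
            unfolding 2(2) Int_assoc
            by (rule compact_Int_closed[OF compact_cube closed_Int]) (rule closed_closed_rat_box)+
          moreover have "D \<inter> C = {}"
            using 2 CG e(2) unfolding E_def by blast
          ultimately show ?thesis
            using compact_thin 2(2) by blast
        qed (simp add: thin_G)
      qed
      ultimately have "thin (cube \<inter> rat_box e)"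
        using thin_subset by blast
      then show False
        using e(1) y unfolding C_def T_def by blast
    qed
    have C_nowhere_in_Z: "\<exists>y. y \<in> C \<inter> rat_box c - Z" if y: "y \<in> C \<inter> rat_box c" for y c
    proof (rule ccontr)
      assume "\<nexists>y. y \<in> C \<inter> rat_box c - Z"
      then have CZ: "C \<inter> rat_box c \<subseteq> Z"
        by blast
      obtain e where e: "y \<in> rat_box e" "closed_rat_box e \<subseteq> rat_box c"
        using y by (auto elim: rat_box_shrink)
      have "compact (C \<inter> closed_rat_box e)"
        by (rule compact_Int_closed[OF C_compact closed_closed_rat_box])
      moreover have "C \<inter> closed_rat_box e \<subseteq> Z"
        using CZ e(2) by blast
      ultimately obtain r where "C \<inter> closed_rat_box e \<subseteq> G r"
        using compact_in_G by blast
      moreover obtain y' where "y' \<in> C \<inter> rat_box e - G r"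
        using C_nowhere_in_G[of y e r] y e(1) by blast
      ultimately show False
        using rat_box_subset_closed_rat_box by blast
    qed
    have C_empty: "C = {}"
    proof (rule ccontr)
      assume "C \<noteq> {}"
      \<comment> \<open>The rank of one chosen witness in the piece; for pieces that do not meet
        \<open>C\<close> the value is arbitrary.\<close>
      define del where "del = (\<lambda>c. lam (SOME y. y \<in> C \<inter> rat_box c - Z))"
      have del: "\<exists>y. y \<in> C \<inter> rat_box c - Z \<and> lam y = del c" if "C \<inter> rat_box c \<noteq> {}" for c
      proof -
        have "\<exists>y. y \<in> C \<inter> rat_box c - Z"
          using C_nowhere_in_Z that by blast
        then have "(SOME y. y \<in> C \<inter> rat_box c - Z) \<in> C \<inter> rat_box c - Z"
          by (rule someI_ex)
        then show ?thesis
          unfolding del_def by blast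
      qed
      have "\<exists>e. lt d e \<and> (\<forall>c. supp c \<subseteq> S d \<longrightarrow> lt (del c) e)" for d
      proof -
        have "countable (insert d (del ` {c. supp c \<subseteq> S d}))"
          using countable_codes[OF S_countable] by simp
        then obtain e where "\<And>x. x \<in> insert d (del ` {c. supp c \<subseteq> S d}) \<Longrightarrow> lt x e"
          by (rule omega1_order_bound[OF lt]) blast
        then show ?thesis
          by blast
      qed
      then have "\<exists>s d. (\<forall>n. \<forall>c. supp c \<subseteq> S (s n) \<longrightarrow> lt (del c) (s (Suc n))) \<and>
        (\<forall>n. lt (s n) (s (Suc n))) \<and> (\<forall>n. lt (s n) d) \<and> (\<forall>c. lt c d \<longrightarrow> (\<exists>n. lt c (s n)))"
        by (rule omega1_order_closing_off[OF lt])
      then obtain s d where s: "\<forall>n. \<forall>c. supp c \<subseteq> S (s n) \<longrightarrow> lt (del c) (s (Suc n))"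
        "\<forall>n. lt (s n) (s (Suc n))" "\<forall>n. lt (s n) d" "\<forall>c. lt c d \<longrightarrow> (\<exists>n. lt c (s n))"
        by (elim exE conjE)
      have S_s_mono: "S (s m) \<subseteq> S (s n)" if "m \<le> n" for m n
        by (rule lift_Suc_mono_le[of "\<lambda>n. S (s n)", OF _ that]) (rule S_mono[OF s(2)[rule_format]])
      have S_d: "\<exists>n. i \<in> S (s n)" if i: "i \<in> S d" for i
      proof -
        consider "lt i d" | r where "lt r d" "i \<in> supps (b r)"
          using i unfolding S_def by blast
        then show ?thesis
        proof cases
          case 1
          then obtain n where "lt i (s n)"
            using s(4) by blast
          then show ?thesis
            unfolding S_def by blast
        next
          case 2
          then obtain n where "lt r (s n)"
            using s(4) by blast
          then show ?thesis
            using 2(2) unfolding S_def by blast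
        qed
      qed
      \<comment> \<open>\<open>S d\<close> is the union of the increasing sets
        \<open>S (s n)\<close>, so a finite support lies in a single stage and the next stage bounds
        the rank.\<close>
      have del_lt: "lt (del c) d" if c: "supp c \<subseteq> S d" for c
      proof -
        have finite_case: "\<exists>n. J \<subseteq> S (s n)" if "finite J" "J \<subseteq> S d" for J
          using that
        proof (induction J)
          case (insert i J)
          then obtain m n where "J \<subseteq> S (s m)" "i \<in> S (s n)"
            using S_d by blast
          then have "insert i J \<subseteq> S (s (max m n))"
            using S_s_mono[of m "max m n"] S_s_mono[of n "max m n"] by auto
          then show ?case
            by blast
        qed simp
        obtain n where "supp c \<subseteq> S (s n)"
          using finite_case[OF finite_supp c] by blast
        then have "lt (del c) (s (Suc n))"
          using s(1) by blast
        then show ?thesis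
          using s(3) lt_trans by blast
      qed
      obtain \<Q> where Q: "countable \<Q>" "\<And>F. F \<in> \<Q> \<Longrightarrow> closed F \<and> cylinder (S d) F"
        "cyl_hull (S d) Z = \<Union> \<Q>"
        by (rule cyl_hull_countable_Union_closed[OF lt Z S_countable[of d]]) blast
      \<comment> \<open>Countably many closed cylinders over \<open>S d\<close> that together
        contain everything to be avoided; the empty set only secures non-emptiness for the
        enumeration.\<close>
      define R where "R = insert {} (\<Q> \<union> G ` {r. lt r d})"
      have R: "countable R" "R \<noteq> {}"
        using Q(1) lt unfolding R_def omega1_order_def by auto
      have R_closed: "closed F \<and> cylinder (S d) F" if F: "F \<in> R" for F
      proof -
        consider "F = {}" | "F \<in> \<Q>" | r where "lt r d" "F = G r"
          using F unfolding R_def by blast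
        then show ?thesis
        proof cases
          case 1
          then show ?thesis
            by (simp add: cylinder_def)
        qed (use Q(2) G_closed G_cylinder in auto)
      qed
      have shrink: "\<exists>e. supp e \<subseteq> S d \<and> C \<inter> rat_box e \<noteq> {} \<and> closed_rat_box e \<subseteq> rat_box c - F"
        if c: "supp c \<subseteq> S d" "C \<inter> rat_box c \<noteq> {}" and F: "F \<in> R" for c F
      proof -
        have "\<exists>y. y \<in> C \<inter> rat_box c - F"
        proof -
          consider "F = {}" | "F \<in> \<Q>" | r where "F = G r"
            using F unfolding R_def by blast
          then show ?thesis
          proof cases
            case 1
            then show ?thesis
              using c(2) by blast
          next
            case 2
            \<comment> \<open>A witness of rank below \<open>d\<close> is separated from
              \<open>Z\<close> by coordinates in \<open>S (lam y)\<close>, all of which belong to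
              \<open>S d\<close>, so it avoids the whole hull at level \<open>d\<close>.\<close>
            obtain y where y: "y \<in> C \<inter> rat_box c - Z" "lam y = del c"
              using del[OF c(2)] by blast
            have "y \<notin> cyl_hull (S (lam y)) Z"
              using lam y(1) by blast
            then have "y \<notin> cyl_hull (S d) Z"
              using cyl_hull_antimono[OF S_mono[OF del_lt[OF c(1)]]] y(2) by auto
            then show ?thesis
              using 2 Q(3) y(1) by blast
          next
            case 3
            then show ?thesis
              using C_nowhere_in_G c(2) by blast
          qed
        qed
        then obtain y where y: "y \<in> C" "y \<in> rat_box c" "y \<notin> F"
          by blast
        have "y \<in> cube"
          using y(1) unfolding C_def by blast
        then obtain a where a: "supp a \<subseteq> S d" "y \<in> rat_box a" "rat_box a \<inter> F = {}"
          using cylinder_avoid[of F "S d" y] R_closed[OF F] y(3) by metis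
        obtain e where "supp e = supp (a @ c)" "y \<in> rat_box e" "closed_rat_box e \<subseteq> rat_box (a @ c)"
          by (rule rat_box_shrink[of y "a @ c"]) (use a y in auto)
        then show ?thesis
          using a c(1) y(1) by (intro exI[of _ e]) auto
      qed
      have "\<forall>c n. \<exists>e. supp c \<subseteq> S d \<and> C \<inter> rat_box c \<noteq> {} \<longrightarrow>
        supp e \<subseteq> S d \<and> C \<inter> rat_box e \<noteq> {} \<and> closed_rat_box e \<subseteq> rat_box c - from_nat_into R n"
        using shrink from_nat_into[OF R(2)] by blast
      then obtain nxt where nxt: "\<And>c n. supp c \<subseteq> S d \<Longrightarrow> C \<inter> rat_box c \<noteq> {} \<Longrightarrow>
        supp (nxt c n) \<subseteq> S d \<and> C \<inter> rat_box (nxt c n) \<noteq> {} \<and>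
        closed_rat_box (nxt c n) \<subseteq> rat_box c - from_nat_into R n"
        by metis
      \<comment> \<open>The Baire argument: nested boxes that start from the whole space, keep
        meeting \<open>C\<close>, and avoid the n-th member of \<open>R\<close> at step n.\<close>
      define t where "t = rec_nat [] (\<lambda>n c. nxt c n)"
      have t: "supp (t n) \<subseteq> S d \<and> C \<inter> rat_box (t n) \<noteq> {}" for n
        by (induction n) (use nxt \<open>C \<noteq> {}\<close> in \<open>auto simp: t_def\<close>)
      have t_Suc: "closed_rat_box (t (Suc n)) \<subseteq> rat_box (t n) - from_nat_into R n" for n
        using nxt[of "t n" n] t by (simp add: t_def)
      have t_mono: "closed_rat_box (t n) \<subseteq> closed_rat_box (t m)" if "m \<le> n" for m n
        using t_Suc rat_box_subset_closed_rat_box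
        by (intro lift_Suc_antimono_le[of "\<lambda>n. closed_rat_box (t n)", OF _ that]) blast
      have "C \<inter> (\<Inter>n\<in>UNIV. closed_rat_box (t n)) \<noteq> {}"
      proof (rule compact_imp_fip_image[OF C_compact])
        fix I :: "nat set" assume "finite I"
        \<comment> \<open>Inserting 0 keeps \<open>Max\<close> meaningful for an empty index
          set.\<close>
        then have "closed_rat_box (t (Max (insert 0 I))) \<subseteq> closed_rat_box (t n)" if "n \<in> I" for n
          using that by (intro t_mono Max_ge) auto
        moreover have "C \<inter> closed_rat_box (t (Max (insert 0 I))) \<noteq> {}"
          using t rat_box_subset_closed_rat_box by blast
        ultimately show "C \<inter> (\<Inter>n\<in>I. closed_rat_box (t n)) \<noteq> {}"
          by blast
      qed (rule closed_closed_rat_box)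
      then obtain y where y: "y \<in> C" "\<And>n. y \<in> closed_rat_box (t n)"
        by blast
      have "y \<notin> F" if "F \<in> R" for F
      proof -
        obtain n where "F = from_nat_into R n"
          using from_nat_into_surj[OF R(1) \<open>F \<in> R\<close>] by metis
        then show ?thesis
          using y(2) t_Suc by blast
      qed
      then have y_hull: "y \<notin> cyl_hull (S d) Z" and y_G: "\<And>r. lt r d \<Longrightarrow> y \<notin> G r"
        unfolding Q(3) R_def by blast+
      have "y \<notin> Z"
        using y_hull subset_cyl_hull[OF Z(2)] by blast
      \<comment> \<open>Being outside the hull at level \<open>d\<close> bounds the rank by
        \<open>d\<close>, so avoiding the \<open>G r\<close> with \<open>r\<close> below
        \<open>d\<close> puts \<open>y\<close> into \<open>L\<close>; but no box of the cover meets
        \<open>C\<close>.\<close>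
      then have "\<not> lt d (lam y)"
        using lam_least y_hull by blast
      then have "y \<in> L"
        using \<open>y \<notin> Z\<close> y(1) y_G lt_linear lt_trans unfolding L_def C_def by blast
      then show False
        using W W_avoids_C y(1) by blast
    qed
    then have "thin cube"
      using compact_thin compact_cube by blast
    then obtain \<V> B where V: "\<V> \<subseteq> \<W>" "countable \<V>" "countable B"
      "cube \<subseteq> (\<Union>c\<in>\<V>. rat_box c) \<union> (\<Union>r\<in>B. G r)"
      unfolding thin_def by blast
    have "countable (B \<union> (\<Union>c\<in>\<V>. supp c))"
      using V(2,3) by (intro countable_Un countable_UN) (simp_all add: countable_finite finite_supp)
    then obtain d where "\<And>x. x \<in> B \<union> (\<Union>c\<in>\<V>. supp c) \<Longrightarrow> lt x d"
      by (rule omega1_order_bound[OF lt]) blast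
    then have d: "\<And>r. r \<in> B \<Longrightarrow> lt r d" "\<And>c. c \<in> \<V> \<Longrightarrow> supp c \<subseteq> S d"
      unfolding S_def by blast+
    \<comment> \<open>Points of rank above \<open>d\<close> avoid the \<open>G r\<close> with
      \<open>r \<in> B\<close>, hence are caught by \<V>, whose supports they see. Points of lower
      or equal rank have their original codes supported in \<open>S d\<close>.\<close>
    let ?V = "\<V> \<union> {c \<in> \<W>. supp c \<subseteq> S d}"
    have "countable {c \<in> \<W>. supp c \<subseteq> S d}"
      by (rule countable_subset[OF _ countable_codes[OF S_countable[of d]]]) blast
    then have "countable ?V" "?V \<subseteq> \<W>"
      using V(1,2) by auto
    moreover have "\<exists>c\<in>?V. y \<in> rat_box c \<and> supp c \<subseteq> S (lam y)" if y: "y \<in> L" for y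
    proof (cases "lt d (lam y)")
      case True
      then have "y \<notin> G r" if "r \<in> B" for r
        using d(1)[OF that] lt_trans y unfolding L_def by blast
      then obtain c where "c \<in> \<V>" "y \<in> rat_box c"
        using V(4) y unfolding L_def by blast
      then show ?thesis
        using d(2) S_mono[OF True] by blast
    next
      case False
      then have "S (lam y) \<subseteq> S d"
        using S_mono lt_linear by blast
      then show ?thesis
        using W[OF y] by blast
    qed
    moreover have "countable (A - (\<Union>c\<in>?V. rat_box c))"
    proof (rule countable_subset)
      show "A - (\<Union>c\<in>?V. rat_box c) \<subseteq> (\<Union>r\<in>B. A \<inter> G r)"
        using V(4) A(1) Z(2) by blast
      show "countable (\<Union>r\<in>B. A \<inter> G r)"
        using V(3) A(3) by blast
    qed
    ultimately show "\<exists>\<V>\<subseteq>\<W>. countable \<V> \<and> (\<forall>y\<in>L. \<exists>c\<in>\<V>. y \<in> rat_box c \<and> supp c \<subseteq> S (lam y)) \<and>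
        countable (A - (\<Union>c\<in>\<V>. rat_box c))"
      by (intro exI[of _ ?V]) blast
  qed
qed

section \<open>Alster spaces are powerfully Lindelof\<close>

text \<open>A tube lemma: finitely many basic boxes cover the compact product and restrict only
  coordinates below \<open>n\<close>. In each factor, \<open>V i\<close> collects the points lying
  in every box side that contains some single \<open>q \<in> Q i\<close>.\<close>

lemma product_tube:
  fixes Q :: "nat \<Rightarrow> 'b :: topological_space set"
  assumes Q: "\<And>i. compact (Q i)" "\<And>i. Q i \<noteq> {}" and U: "open U" "{f. \<forall>i. f i \<in> Q i} \<subseteq> U"
  obtains n V where "\<And>i. open (V i)" "\<And>i. Q i \<subseteq> V i" "{f. \<forall>i<n. f i \<in> V i} \<subseteq> U"
proof -
  let ?P = "{f. \<forall>i. f i \<in> Q i}"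
  have "\<forall>f\<in>?P. \<exists>X. f \<in> PiE UNIV X \<and> (\<forall>i. open (X i)) \<and> finite {i. X i \<noteq> UNIV} \<and> PiE UNIV X \<subseteq> U"
  proof
    fix f assume "f \<in> ?P"
    then have "f \<in> U"
      using U(2) by blast
    then show "\<exists>X. f \<in> PiE UNIV X \<and> (\<forall>i. open (X i)) \<and> finite {i. X i \<noteq> UNIV} \<and> PiE UNIV X \<subseteq> U"
      using product_topology_open_contains_basis[of "\<lambda>_. euclidean" UNIV U f] U(1)
      unfolding open_fun_def by auto
  qed
  then obtain X where "\<forall>f\<in>?P. f \<in> PiE UNIV (X f) \<and> (\<forall>i. open (X f i)) \<and>
      finite {i. X f i \<noteq> UNIV} \<and> PiE UNIV (X f) \<subseteq> U"
    by (rule bchoice[THEN exE])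
  then have X: "f \<in> PiE UNIV (X f)" "open (X f i)" "finite {i. X f i \<noteq> UNIV}" "PiE UNIV (X f) \<subseteq> U"
    if "f \<in> ?P" for f i
    using that by blast+
  have cover: "?P \<subseteq> (\<Union>f\<in>?P. PiE UNIV (X f))"
    using X(1) by blast
  have open_X: "open (PiE UNIV (X f))" if "f \<in> ?P" for f
    by (rule open_PiE[OF X(2,3)[OF that]])
  obtain F where F: "F \<subseteq> ?P" "finite F" "?P \<subseteq> (\<Union>f\<in>F. PiE UNIV (X f))"
    by (rule compactE_image[OF compact_product[OF Q(1)] open_X cover])
  have "finite (\<Union>f\<in>F. {i. X f i \<noteq> UNIV})"
    by (rule finite_UN_I[OF F(2)], rule X(3)) (use F(1) in blast)
  then obtain n where "\<forall>i\<in>(\<Union>f\<in>F. {i. X f i \<noteq> UNIV}). i < n"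
    unfolding finite_nat_set_iff_bounded by (rule exE)
  then have n: "X f i = UNIV" if "f \<in> F" "\<not> i < n" for f i
    using that by blast
  define V where "V = (\<lambda>i. \<Union>q\<in>Q i. \<Inter>f\<in>{f \<in> F. q \<in> X f i}. X f i)"
  have "open (V i)" for i
    unfolding V_def
    by (rule open_UN, rule ballI, rule open_INT, simp add: F(2), rule ballI, rule X(2))
       (use F(1) in blast)
  moreover have "Q i \<subseteq> V i" for i
    unfolding V_def by blast
  moreover have "{f. \<forall>i<n. f i \<in> V i} \<subseteq> U"
  proof
    fix g assume "g \<in> {f. \<forall>i<n. f i \<in> V i}"
    \<comment> \<open>The point \<open>g\<close> is shadowed by a point of the compact product: any
      box that contains the shadow contains \<open>g\<close>. Beyond \<open>n\<close> any element of
      \<open>Q i\<close> will do.\<close>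
    then have "\<forall>i. \<exists>q. q \<in> Q i \<and> (i < n \<longrightarrow> (\<forall>f\<in>F. q \<in> X f i \<longrightarrow> g i \<in> X f i))"
      using Q(2) unfolding V_def by blast
    then obtain q where q: "\<And>i. q i \<in> Q i" "\<And>i f. i < n \<Longrightarrow> f \<in> F \<Longrightarrow> q i \<in> X f i \<Longrightarrow> g i \<in> X f i"
      by metis
    have "q \<in> ?P"
      using q(1) by blast
    then obtain f where f: "f \<in> F" "q \<in> PiE UNIV (X f)"
      using F(3) by blast
    have "g i \<in> X f i" for i
      using q(2)[of i f] n[of f i] f by (cases "i < n") auto
    then have "g \<in> PiE UNIV (X f)"
      by auto
    then show "g \<in> U"
      using X(4)[of f] f(1) F(1) by blast
  qed
  ultimately show thesis
    by (rule that[of V n])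
qed

lemma open_imp_gdelta:
  assumes "open U"
  shows "gdelta U"
proof -
  have "gdelta (\<Inter> (range (\<lambda>_ :: nat. U)))"
    by (rule gdelta.intros) (rule assms)
  then show ?thesis
    by simp
qed

lemma gdelta_countable_INT:
  assumes "countable I" "\<And>i. i \<in> I \<Longrightarrow> gdelta (H i)"
  shows "gdelta (\<Inter>i\<in>I. H i)"
proof (cases "I = {}")
  case True
  then show ?thesis
    by (simp add: open_imp_gdelta)
next
  case False
  have "\<forall>i\<in>I. \<exists>V :: nat \<Rightarrow> _. (\<forall>n. open (V n)) \<and> H i = \<Inter> (range V)"
  proof
    fix i assume "i \<in> I"
    from assms(2)[OF this] show "\<exists>V :: nat \<Rightarrow> _. (\<forall>n. open (V n)) \<and> H i = \<Inter> (range V)"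
      by cases blast
  qed
  then obtain V :: "_ \<Rightarrow> nat \<Rightarrow> _" where "\<forall>i\<in>I. (\<forall>n. open (V i n)) \<and> H i = \<Inter> (range (V i))"
    by (rule bchoice[THEN exE])
  then have V: "open (V i n)" "H i = \<Inter> (range (V i))" if "i \<in> I" for i n
    using that by blast+
  let ?W = "\<lambda>m. V (from_nat_into I (fst (prod_decode m))) (snd (prod_decode m))"
  have "gdelta (\<Inter> (range ?W))"
    by (rule gdelta.intros, rule V(1), rule from_nat_into[OF False])
  moreover have "\<Inter> (range ?W) = (\<Inter>i\<in>I. H i)"
  proof
    show "\<Inter> (range ?W) \<subseteq> (\<Inter>i\<in>I. H i)"
    proof (intro INT_greatest subsetI)
      fix i x assume i: "i \<in> I" and x: "x \<in> \<Inter> (range ?W)"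
      obtain k where k: "from_nat_into I k = i"
        using from_nat_into_surj[OF assms(1) i] by blast
      have "x \<in> V i n" for n
      proof -
        have "x \<in> ?W (prod_encode (k, n))"
          using x by blast
        then show ?thesis
          by (simp add: k)
      qed
      then show "x \<in> H i"
        using V(2)[OF i] by blast
    qed
    show "(\<Inter>i\<in>I. H i) \<subseteq> \<Inter> (range ?W)"
    proof (rule INT_greatest)
      fix m
      have "(\<Inter>i\<in>I. H i) \<subseteq> H (from_nat_into I (fst (prod_decode m)))"
        by (rule INT_lower[OF from_nat_into[OF False]])
      also have "\<dots> \<subseteq> ?W m"
        unfolding V(2)[OF from_nat_into[OF False]] by (rule INT_lower) simp
      finally show "(\<Inter>i\<in>I. H i) \<subseteq> ?W m" .
    qed
  qed
  ultimately show ?thesis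
    by simp
qed

text \<open>If no countable subfamily covers, choose the compact sets \<open>K 0, K 1, \<dots>\<close> one at a time so that
  for all \<open>n\<close> and all \<open>G\<^sub>\<delta>\<close> neighbourhoods of \<open>K 0, \<dots>, K (n - 1)\<close> simultaneously the
  corresponding part of the power is not countably covered. This contradicts the
  compactness of the product of the \<open>K i\<close>.\<close>

theorem Alster_imp_power_Lindelof:
  fixes Z :: "'b :: topological_space set"
  assumes Alster: "\<And>H. (\<And>Q. compact Q \<Longrightarrow> Q \<subseteq> Z \<Longrightarrow> gdelta (H Q) \<and> Q \<subseteq> H Q) \<Longrightarrow>
      \<exists>\<Q>. countable \<Q> \<and> (\<forall>Q\<in>\<Q>. compact Q \<and> Q \<subseteq> Z) \<and> Z \<subseteq> (\<Union>Q\<in>\<Q>. H Q)"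
    and \<O>: "\<And>U. U \<in> \<O> \<Longrightarrow> open U" "{z :: nat \<Rightarrow> 'b. \<forall>i. z i \<in> Z} \<subseteq> \<Union> \<O>"
  shows "\<exists>\<V>\<subseteq>\<O>. countable \<V> \<and> {z :: nat \<Rightarrow> 'b. \<forall>i. z i \<in> Z} \<subseteq> \<Union> \<V>"
proof (rule ccontr)
  define W where "W = {z :: nat \<Rightarrow> 'b. \<forall>i. z i \<in> Z}"
  define good where "good = (\<lambda>P. \<exists>\<V>\<subseteq>\<O>. countable \<V> \<and> P \<subseteq> \<Union> \<V>)"
  assume "\<not> ?thesis"
  then have "\<not> good W"
    by (simp add: good_def W_def)
  have good_subset: "good P" if "good R" "P \<subseteq> R" for P R
    using that unfolding good_def by (meson order_trans)
  \<comment> \<open>Quantifying over all neighbourhoods \<open>H\<close> at once keeps the choice of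
    the next compact set independent of any particular neighbourhoods.\<close>
  define bad where "bad = (\<lambda>n Q. (\<forall>i<n. compact (Q i) \<and> Q i \<subseteq> Z) \<and>
    (\<forall>H. (\<forall>i<n. gdelta (H i) \<and> Q i \<subseteq> H i) \<longrightarrow> \<not> good {z \<in> W. \<forall>i<n. z i \<in> H i}))"
  have bad_cong: "bad n Q'" if "bad n Q" "\<And>i. i < n \<Longrightarrow> Q i = Q' i" for n Q Q'
    using that unfolding bad_def by simp
  have step: "\<exists>Q'. bad (Suc n) Q' \<and> (\<forall>i<n. Q' i = Q i)" if Q: "bad n Q" for n Q
  proof (rule ccontr)
    assume contra: "\<not> ?thesis"
    have "\<forall>q\<in>{q. compact q \<and> q \<subseteq> Z}. \<exists>H. (\<forall>i<n. gdelta (H i) \<and> Q i \<subseteq> H i) \<and>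
        (gdelta (H n) \<and> q \<subseteq> H n) \<and> good {z \<in> W. \<forall>i<Suc n. z i \<in> H i}"
    proof
      fix q assume "q \<in> {q. compact q \<and> q \<subseteq> Z}"
      then have q: "compact q" "q \<subseteq> Z"
        by auto
      have "\<not> bad (Suc n) (Q(n := q))"
        using contra by auto
      moreover have "\<forall>i<Suc n. compact ((Q(n := q)) i) \<and> (Q(n := q)) i \<subseteq> Z"
        using Q q unfolding bad_def by (auto simp: less_Suc_eq)
      ultimately have "\<exists>H. (\<forall>i<Suc n. gdelta (H i) \<and> (Q(n := q)) i \<subseteq> H i) \<and>
          good {z \<in> W. \<forall>i<Suc n. z i \<in> H i}"
        unfolding bad_def by meson
      then obtain H where H: "\<forall>i<Suc n. gdelta (H i) \<and> (Q(n := q)) i \<subseteq> H i"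
        "good {z \<in> W. \<forall>i<Suc n. z i \<in> H i}"
        by (elim exE conjE)
      have "\<forall>i<n. gdelta (H i) \<and> Q i \<subseteq> H i"
      proof (intro allI impI)
        fix i assume "i < n"
        then show "gdelta (H i) \<and> Q i \<subseteq> H i"
          using H(1)[rule_format, of i] by simp
      qed
      moreover have "gdelta (H n) \<and> q \<subseteq> H n"
        using H(1)[rule_format, of n] by simp
      ultimately show "\<exists>H. (\<forall>i<n. gdelta (H i) \<and> Q i \<subseteq> H i) \<and>
          (gdelta (H n) \<and> q \<subseteq> H n) \<and> good {z \<in> W. \<forall>i<Suc n. z i \<in> H i}"
        using H(2) by (intro exI[of _ H] conjI) simp_all
    qed
    then obtain h where h_all: "\<forall>q\<in>{q. compact q \<and> q \<subseteq> Z}.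
        (\<forall>i<n. gdelta (h q i) \<and> Q i \<subseteq> h q i) \<and>
        (gdelta (h q n) \<and> q \<subseteq> h q n) \<and> good {z \<in> W. \<forall>i<Suc n. z i \<in> h q i}"
      by (rule bchoice[THEN exE])
    have h: "i < n \<Longrightarrow> gdelta (h q i) \<and> Q i \<subseteq> h q i" "gdelta (h q n) \<and> q \<subseteq> h q n"
      "good {z \<in> W. \<forall>i<Suc n. z i \<in> h q i}" if q: "compact q" "q \<subseteq> Z" for q i
      using h_all[rule_format, of q] q by auto
    \<comment> \<open>If every candidate for coordinate \<open>n\<close> is spoiled by some
      \<open>h q\<close>, countably many of the sets \<open>h q n\<close> cover \<open>Z\<close>.
      Intersecting the other \<open>h q i\<close> over these \<open>q\<close> gives
      \<open>G\<^sub>\<delta>\<close> sets that refute \<open>bad n Q\<close>.\<close>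
    have "\<exists>\<Q>. countable \<Q> \<and> (\<forall>q\<in>\<Q>. compact q \<and> q \<subseteq> Z) \<and> Z \<subseteq> (\<Union>q\<in>\<Q>. h q n)"
      by (rule Alster) (rule h(2))
    then obtain \<Q> where \<Q>_all: "countable \<Q>" "\<forall>q\<in>\<Q>. compact q \<and> q \<subseteq> Z" "Z \<subseteq> (\<Union>q\<in>\<Q>. h q n)"
      by (elim exE conjE)
    then have \<Q>: "countable \<Q>" "\<And>q. q \<in> \<Q> \<Longrightarrow> compact q" "\<And>q. q \<in> \<Q> \<Longrightarrow> q \<subseteq> Z"
      "Z \<subseteq> (\<Union>q\<in>\<Q>. h q n)"
      by simp_all
    have "\<not> good {z \<in> W. \<forall>i<n. z i \<in> (\<Inter>q\<in>\<Q>. h q i)}"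
    proof -
      have G: "gdelta (\<Inter>q\<in>\<Q>. h q i) \<and> Q i \<subseteq> (\<Inter>q\<in>\<Q>. h q i)" if "i < n" for i
      proof (rule conjI)
        show "gdelta (\<Inter>q\<in>\<Q>. h q i)"
          by (rule gdelta_countable_INT[OF \<Q>(1)]) (simp add: h(1) \<Q>(2,3) that)
        show "Q i \<subseteq> (\<Inter>q\<in>\<Q>. h q i)"
          by (rule INT_greatest) (simp add: h(1) \<Q>(2,3) that)
      qed
      have all_H: "\<forall>H. (\<forall>i<n. gdelta (H i) \<and> Q i \<subseteq> H i) \<longrightarrow> \<not> good {z \<in> W. \<forall>i<n. z i \<in> H i}"
        using Q unfolding bad_def by (rule conjunct2)
      show ?thesis
        by (rule mp[OF spec[OF all_H, of "\<lambda>i. \<Inter>q\<in>\<Q>. h q i"]]) (intro allI impI G)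
    qed
    moreover have "good {z \<in> W. \<forall>i<n. z i \<in> (\<Inter>q\<in>\<Q>. h q i)}"
    proof -
      have "\<forall>q\<in>\<Q>. \<exists>\<V>\<subseteq>\<O>. countable \<V> \<and> {z \<in> W. \<forall>i<Suc n. z i \<in> h q i} \<subseteq> \<Union> \<V>"
      proof
        fix q assume "q \<in> \<Q>"
        with h(3)[OF \<Q>(2,3), of q] show "\<exists>\<V>\<subseteq>\<O>. countable \<V> \<and> {z \<in> W. \<forall>i<Suc n. z i \<in> h q i} \<subseteq> \<Union> \<V>"
          unfolding good_def by simp
      qed
      then obtain V where "\<forall>q\<in>\<Q>. V q \<subseteq> \<O> \<and> countable (V q) \<and>
          {z \<in> W. \<forall>i<Suc n. z i \<in> h q i} \<subseteq> \<Union> (V q)"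
        by (rule bchoice[THEN exE])
      then have V: "V q \<subseteq> \<O>" "countable (V q)" "{z \<in> W. \<forall>i<Suc n. z i \<in> h q i} \<subseteq> \<Union> (V q)"
        if "q \<in> \<Q>" for q
        using that by simp_all
      have "{z \<in> W. \<forall>i<n. z i \<in> (\<Inter>q\<in>\<Q>. h q i)} \<subseteq> \<Union> (\<Union>q\<in>\<Q>. V q)"
      proof
        fix z assume z: "z \<in> {z \<in> W. \<forall>i<n. z i \<in> (\<Inter>q\<in>\<Q>. h q i)}"
        then have "z n \<in> Z"
          by (simp add: W_def)
        then obtain q where q: "q \<in> \<Q>" "z n \<in> h q n"
          using \<Q>(4) by blast
        then have "z \<in> {z \<in> W. \<forall>i<Suc n. z i \<in> h q i}"
          using z by (auto simp: less_Suc_eq)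
        then show "z \<in> \<Union> (\<Union>q\<in>\<Q>. V q)"
          using V(3)[OF q(1)] q(1) by blast
      qed
      moreover have "countable (\<Union>q\<in>\<Q>. V q)"
        by (rule countable_UN[OF \<Q>(1) V(2)])
      moreover have "(\<Union>q\<in>\<Q>. V q) \<subseteq> \<O>"
        by (rule UN_least[OF V(1)])
      ultimately show ?thesis
        unfolding good_def by (intro exI[of _ "\<Union>q\<in>\<Q>. V q"] conjI)
    qed
    ultimately show False
      by contradiction
  qed
  have "bad 0 Q" for Q
    using \<open>\<not> good W\<close> by (simp add: bad_def)
  then have "\<exists>F. \<forall>n. bad n (F n) \<and> (\<forall>i<n. F (Suc n) i = F n i)"
    using step by (intro dependent_nat_choice) simp_all
  then obtain F where "\<forall>n. bad n (F n) \<and> (\<forall>i<n. F (Suc n) i = F n i)" ..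
  then have F: "bad n (F n)" "i < n \<Longrightarrow> F (Suc n) i = F n i" for n i
    by simp_all
  \<comment> \<open>\<open>F n\<close> matters only below \<open>n\<close>; coordinate
    \<open>i\<close> is fixed for good from stage \<open>Suc i\<close> on.\<close>
  define K where "K = (\<lambda>i. F (Suc i) i)"
  have "F n i = K i" if "i < n" for n i
    using that
  proof (induction n)
    case (Suc n)
    then show ?case
      using F(2)[of i n] by (cases "i = n") (auto simp: K_def)
  qed simp
  then have bad_K: "bad n K" for n
    using bad_cong[OF F(1)] by blast
  have K: "compact (K i)" "K i \<subseteq> Z" for i
    using bad_K[of "Suc i"] by (auto simp: bad_def)
  have K_nonempty: "K i \<noteq> {}" for i
  proof
    assume "K i = {}"
    \<comment> \<open>An empty factor would admit the empty set as its neighbourhood, and the empty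
      part of the power is trivially covered.\<close>
    then have K_if: "\<forall>j<Suc i. gdelta (if j = i then {} else UNIV :: 'b set) \<and> K j \<subseteq> (if j = i then {} else UNIV)"
      by (simp add: open_imp_gdelta)
    have all_H: "\<forall>H. (\<forall>j<Suc i. gdelta (H j) \<and> K j \<subseteq> H j) \<longrightarrow> \<not> good {z \<in> W. \<forall>j<Suc i. z j \<in> H j}"
      using bad_K[of "Suc i"] unfolding bad_def by (rule conjunct2)
    have "\<not> good {z \<in> W. \<forall>j<Suc i. z j \<in> (if j = i then {} else UNIV)}"
      by (rule mp[OF spec[OF all_H, of "\<lambda>j. if j = i then {} else UNIV"] K_if])
    moreover have "{z \<in> W. \<forall>j<Suc i. z j \<in> (if j = i then {} else UNIV)} = {}"
      by auto
    moreover have "good {}"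
      unfolding good_def by (rule exI[of _ "{}"]) simp
    ultimately show False
      by simp
  qed
  have "{f. \<forall>i. f i \<in> K i} \<subseteq> \<Union> \<O>"
    using \<O>(2) K(2) by blast
  then obtain \<V> where \<V>: "\<V> \<subseteq> \<O>" "finite \<V>" "{f. \<forall>i. f i \<in> K i} \<subseteq> \<Union> \<V>"
    by (rule compactE[OF compact_product[OF K(1)] _ \<O>(1)])
  have "open (\<Union> \<V>)"
    by (rule open_Union) (use \<V>(1) \<O>(1) in blast)
  then obtain n V where V: "\<And>i. open (V i)" "\<And>i. K i \<subseteq> V i" "{f. \<forall>i<n. f i \<in> V i} \<subseteq> \<Union> \<V>"
    by (rule product_tube[OF K(1) K_nonempty _ \<V>(3)]) blast
  have "\<not> good {z \<in> W. \<forall>i<n. z i \<in> V i}"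
    using bad_K[of n] V(2) open_imp_gdelta[OF V(1)] unfolding bad_def by simp
  moreover have "good {z \<in> W. \<forall>i<n. z i \<in> V i}"
    unfolding good_def using \<V>(1,2) V(3) by (intro exI[of _ \<V>]) (auto simp: countable_finite)
  ultimately show False
    by contradiction
qed

section \<open>Reduction to subsets of the cube\<close>

text \<open>Closed subsets and continuous images inherit the property; the remaining work is to
  carry \<open>Y\<close> over to the type on which the hypothesis quantifies.\<close>

lemma productively_Lindelof_imp_Lindelof_factor:
  fixes X :: "'a topology" and e :: "'a \<Rightarrow> real \<Rightarrow> real"
  assumes X: "productively_Lindelof TYPE(((nat \<Rightarrow> 'a) \<times> real) set set) X"
    and A: "closedin X A" and e: "continuous_map X euclidean e"
  shows "Lindelof_factor (e ` A)"
  unfolding Lindelof_factor_def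
proof (intro allI impI)
  fix Y :: "(real \<Rightarrow> real) topology" assume Y: "Lindelof_space Y"
  obtain pr :: "real \<times> real \<Rightarrow> real" where pr: "inj pr"
    using pairs_lepoll_real[OF lepoll_refl lepoll_refl] by (auto simp: lepoll_UNIV_iff_inj)
  \<comment> \<open>A function is stored as its graph, one singleton for each coded pair; the first
    component of the element is a dummy.\<close>
  define j :: "(real \<Rightarrow> real) \<Rightarrow> ((nat \<Rightarrow> 'a) \<times> real) set set" where
    "j = (\<lambda>f. range (\<lambda>x. {(undefined, pr (x, f x))}))"
  have "inj j"
  proof (rule injI)
    fix f g assume eq: "j f = j g"
    have "f x = g x" for x
    proof -
      have "{(undefined, pr (x, f x))} \<in> j g"
        unfolding eq[symmetric] by (simp add: j_def)
      then obtain x' where "pr (x, f x) = pr (x', g x')"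
        by (auto simp: j_def)
      then show ?thesis
        using pr by (auto dest: injD)
    qed
    then show "f = g" ..
  qed
  define k where "k = inv j"
  have kj: "k (j f) = f" for f
    unfolding k_def by (rule inv_f_f[OF \<open>inj j\<close>])
  define Y' where "Y' = pullback_topology (range j) k Y"
  have topY': "topspace Y' = j ` topspace Y"
    by (auto simp: Y'_def topspace_pullback_topology kj)
  have j: "continuous_map Y Y' j"
    unfolding Y'_def by (rule continuous_map_pullback') (auto simp: o_def kj)
  have k: "continuous_map Y' Y k"
    using continuous_map_pullback[OF continuous_map_id, of "range j" k Y] by (simp add: Y'_def)
  have "Lindelof_space Y'"
    by (rule Lindelof_space_continuous_map_image[OF Y j]) (simp add: topY')
  then have "Lindelof_space (prod_topology X Y')"
    using X by (auto simp: productively_Lindelof_def)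
  moreover have "closedin (prod_topology X Y') (A \<times> topspace Y')"
    using A by (simp add: closedin_prod_Times_iff)
  ultimately have "Lindelof_space (subtopology (prod_topology X Y') (A \<times> topspace Y'))"
    by (rule Lindelof_space_closedin_subtopology)
  then have lin: "Lindelof_space (prod_topology (subtopology X A) Y')"
    by (simp add: prod_topology_subtopology(1) subtopology_Times flip: prod_topology_subtopology)
  have "continuous_map (subtopology X A) (top_of_set (e ` A)) e"
    using e by (auto simp: continuous_map_in_subtopology continuous_map_from_subtopology)
  then have "continuous_map (prod_topology (subtopology X A) Y') (prod_topology (top_of_set (e ` A)) Y)
    (\<lambda>(x, y). (e x, k y))"
    using k by (simp add: continuous_map_prod_top)
  then show "Lindelof_space (prod_topology (top_of_set (e ` A)) Y)"
  proof (rule Lindelof_space_continuous_map_image[OF lin])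
    have "topspace (subtopology X A) = A"
      using closedin_subset[OF A] by auto
    moreover have "k ` topspace Y' = topspace Y"
      by (simp add: topY' image_image kj)
    moreover have "(\<lambda>(x, y). (e x, k y)) ` (A \<times> topspace Y') = e ` A \<times> k ` topspace Y'"
      by force
    ultimately show "(\<lambda>(x, y). (e x, k y)) ` topspace (prod_topology (subtopology X A) Y') =
        topspace (prod_topology (top_of_set (e ` A)) Y)"
      by simp
  qed
qed

text \<open>Well-founded trees with countable branching are terms for iterated \<open>\<omega>\<close>-ary operations; the
  closure of a point under countably many such operations has at most as many elements as there
  are terms.\<close>

datatype omega_tree = Leaf | Node nat "nat \<Rightarrow> omega_tree"

text \<open>A tree becomes a function on finite paths: 0 marks a leaf and everything below it, hence
  the \<open>Suc\<close> at nodes.\<close>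

primrec label :: "omega_tree \<Rightarrow> nat list \<Rightarrow> nat" where
  "label Leaf = (\<lambda>_. 0)"
| "label (Node k t) = (\<lambda>p. case p of [] \<Rightarrow> Suc k | n # p' \<Rightarrow> label (t n) p')"

lemma inj_label: "inj label"
proof (rule injI)
  fix t u assume "label t = label u"
  then show "t = u"
  proof (induction t arbitrary: u)
    case Leaf
    then have "label u [] = 0"
      by (metis label.simps(1))
    then show ?case
      by (cases u) simp_all
  next
    case (Node k t)
    obtain k' t' where u: "u = Node k' t'"
      using fun_cong[OF Node.prems, of "[]"] by (cases u) auto
    have "k = k'"
      using fun_cong[OF Node.prems, of "[]"] by (simp add: u)
    moreover have "t n = t' n" for n
    proof (rule Node.IH)
      show "label (t n) = label (t' n)"
      proof
        fix p
        show "label (t n) p = label (t' n) p"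
          using fun_cong[OF Node.prems, of "n # p"] by (simp add: u)
      qed
    qed simp
    ultimately show ?case
      by (auto simp: u)
  qed
qed

lemma omega_trees_lepoll_real: "(UNIV :: omega_tree set) \<lesssim> (UNIV :: real set)"
proof -
  have "inj (\<lambda>t. label t \<circ> from_nat)"
  proof (rule injI)
    fix t u assume eq: "label t \<circ> from_nat = label u \<circ> (from_nat :: nat \<Rightarrow> nat list)"
    have "label t p = label u p" for p
      using fun_cong[OF eq, of "to_nat p"] by simp
    then have "label t = label u" ..
    then show "t = u"
      by (rule injD[OF inj_label])
  qed
  then have "(UNIV :: omega_tree set) \<lesssim> (UNIV :: (nat \<Rightarrow> nat) set)"
    by (auto simp: lepoll_UNIV_iff_inj)
  then show ?thesis
    using sequences_lepoll_real[OF countable_type_lepoll_real] by (rule lepoll_trans)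
qed

primrec tree_value :: "'a \<Rightarrow> (nat \<Rightarrow> (nat \<Rightarrow> 'a) \<Rightarrow> 'a) \<Rightarrow> omega_tree \<Rightarrow> 'a" where
  "tree_value a f Leaf = a"
| "tree_value a f (Node k t) = f k (\<lambda>n. tree_value a f (t n))"

lemma closure_lepoll_real:
  fixes f :: "nat \<Rightarrow> (nat \<Rightarrow> 'a) \<Rightarrow> 'a"
  assumes "a \<in> B" and "\<And>k s. range s \<subseteq> B \<Longrightarrow> f k s \<in> B"
  obtains A where "a \<in> A" "A \<subseteq> B" "\<And>k s. range s \<subseteq> A \<Longrightarrow> f k s \<in> A" "A \<lesssim> (UNIV :: real set)"
proof -
  let ?A = "range (tree_value a f)"
  have "a \<in> ?A"
    by (rule range_eqI[of _ _ Leaf]) simp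
  moreover have "tree_value a f t \<in> B" for t
  proof (induction t)
    case Leaf
    show ?case
      using assms(1) by simp
  next
    case (Node k t)
    then show ?case
      using assms(2)[of "\<lambda>n. tree_value a f (t n)" k] by auto
  qed
  then have "?A \<subseteq> B"
    by blast
  moreover have "f k s \<in> ?A" if s: "range s \<subseteq> ?A" for k s
  proof -
    have "\<forall>n. \<exists>t. s n = tree_value a f t"
      using s by blast
    then obtain t where "\<forall>n. s n = tree_value a f (t n)"
      by (rule choice[THEN exE])
    then have "s = (\<lambda>n. tree_value a f (t n))"
      by (simp add: fun_eq_iff)
    then have "f k s = tree_value a f (Node k t)"
      by simp
    then show ?thesis
      by (rule range_eqI)
  qed
  moreover have "?A \<lesssim> (UNIV :: real set)"
    using image_lepoll omega_trees_lepoll_real by (rule lepoll_trans)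
  ultimately show thesis
    by (rule that[of ?A])
qed

text \<open>Each point of the power of \<open>A\<close> contributes one function per coordinate;
  this makes \<open>real\<close> large enough to index them all.\<close>

lemma sequence_indices_lepoll_real:
  assumes "A \<lesssim> (UNIV :: real set)"
  obtains idx :: "real \<Rightarrow> (nat \<Rightarrow> 'a) \<times> nat" where "{p. \<forall>i. p i \<in> A} \<times> UNIV \<subseteq> range idx"
proof -
  obtain g :: "real \<Rightarrow> 'a" where g: "A \<subseteq> range g"
    using assms unfolding lepoll_iff by blast
  have "(UNIV :: ((nat \<Rightarrow> real) \<times> nat) set) \<lesssim> (UNIV :: real set)"
    by (intro pairs_lepoll_real sequences_lepoll_real countable_type_lepoll_real lepoll_refl)
  then obtain s :: "real \<Rightarrow> (nat \<Rightarrow> real) \<times> nat" where s: "UNIV \<subseteq> range s"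
    unfolding lepoll_iff by blast
  have "(p, n) \<in> range (\<lambda>r. (g \<circ> fst (s r), snd (s r)))" if p: "\<forall>i. p i \<in> A" for p n
  proof -
    have "\<forall>i. \<exists>x. p i = g x"
      using p g by blast
    then obtain u where u: "\<forall>i. p i = g (u i)"
      by (rule choice[THEN exE])
    obtain r where "s r = (u, n)"
      using s by (metis UNIV_I image_iff subset_UNIV subset_antisym)
    then have "(p, n) = (g \<circ> fst (s r), snd (s r))"
      using u by (auto simp: fun_eq_iff)
    then show ?thesis
      by (rule range_eqI)
  qed
  then show thesis
    by (intro that[of "\<lambda>r. (g \<circ> fst (s r), snd (s r))"]) auto
qed

text \<open>The functions are 1 outside the sides of a basic box; from \<open>n\<close> on the side
  is the whole space, so no condition is left.\<close>

lemma completely_regular_power_basis: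
  assumes X: "completely_regular_space X"
    and U: "openin (product_topology (\<lambda>_ :: nat. X) UNIV) U" and p: "p \<in> U"
  obtains n \<phi> where "\<And>i. continuous_map X (top_of_set {0..1 :: real}) (\<phi> i)" "\<And>i. \<phi> i (p i) = 0"
    "{q. (\<forall>i. q i \<in> topspace X) \<and> (\<forall>i<n. \<phi> i (q i) < 1)} \<subseteq> U"
proof -
  obtain V where V: "p \<in> PiE UNIV V" "\<forall>i. openin X (V i)" "finite {i. V i \<noteq> topspace X}" "PiE UNIV V \<subseteq> U"
    using product_topology_open_contains_basis[OF U p] by blast
  have "\<forall>i. \<exists>f. continuous_map X (top_of_set {0..1 :: real}) f \<and> f (p i) = 0 \<and> f ` (topspace X - V i) \<subseteq> {1}"
  proof
    fix i
    have "p i \<in> V i"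
      using V(1) by auto
    moreover have "V i \<subseteq> topspace X"
      using V(2) openin_subset by blast
    moreover have "closedin X (topspace X - V i)"
      using V(2) by blast
    ultimately show "\<exists>f. continuous_map X (top_of_set {0..1 :: real}) f \<and> f (p i) = 0 \<and> f ` (topspace X - V i) \<subseteq> {1}"
      using X unfolding completely_regular_space_def by blast
  qed
  then obtain \<phi> where \<phi>: "\<forall>i. continuous_map X (top_of_set {0..1 :: real}) (\<phi> i) \<and> \<phi> i (p i) = 0 \<and>
      \<phi> i ` (topspace X - V i) \<subseteq> {1}"
    by (rule choice[THEN exE])
  obtain n where n: "\<forall>i\<in>{i. V i \<noteq> topspace X}. i < n"
    using V(3) unfolding finite_nat_set_iff_bounded by (rule exE)
  have "{q. (\<forall>i. q i \<in> topspace X) \<and> (\<forall>i<n. \<phi> i (q i) < 1)} \<subseteq> U"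
  proof
    fix q assume q: "q \<in> {q. (\<forall>i. q i \<in> topspace X) \<and> (\<forall>i<n. \<phi> i (q i) < 1)}"
    have "q i \<in> V i" for i
    proof (cases "i < n")
      case True
      then show ?thesis
        using q \<phi>[rule_format, of i] by fastforce
    next
      case False
      then have "V i = topspace X"
        using n by blast
      then show ?thesis
        using q by simp
    qed
    then have "q \<in> PiE UNIV V"
      by auto
    then show "q \<in> U"
      using V(4) by blast
  qed
  then show thesis
    using \<phi> by (intro that[of \<phi> n]) simp_all
qed

lemma productively_Lindelof_imp_Lindelof:
  assumes "productively_Lindelof TYPE('b) X"
  shows "Lindelof_space X"
proof -
  let ?Y = "discrete_topology {undefined :: 'b}"
  have "Lindelof_space ?Y"
    by (intro compact_imp_Lindelof_space) (simp add: compact_space_discrete_topology)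
  then have "Lindelof_space (prod_topology X ?Y)"
    using assms by (simp add: productively_Lindelof_def)
  then show ?thesis
    by (rule Lindelof_space_continuous_map_image[OF _ continuous_map_fst]) auto
qed

theorem theorem1p4:
  fixes X :: "'a topology"
  assumes "continuum_hypothesis"
    and "productively_Lindelof TYPE(((nat \<Rightarrow> 'a) \<times> real) set set) X"
    and "sequential_space X"
    and "T3_space X"
  shows "powerfully_Lindelof X"
proof -
  obtain lt where lt: "omega1_order lt"
    using omega1_order_exists[OF assms(1)] by blast
  have reg: "regular_space X" and t1: "t1_space X"
    using assms(4) by (auto simp: T3_space_def)
  have haus: "Hausdorff_space X"
    using reg t1 by (rule regular_t1_imp_Hausdorff_space)
  have creg: "completely_regular_space X"
    by (intro normal_imp_completely_regular_space disjI2 regular_Lindelof_imp_normal_space reg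
        productively_Lindelof_imp_Lindelof[OF assms(2)])
  have topX: "topspace (product_topology (\<lambda>_ :: nat. X) UNIV) = {p. \<forall>i. p i \<in> topspace X}"
    by auto
  have "\<exists>\<V>. countable \<V> \<and> \<V> \<subseteq> \<U> \<and> {p :: nat \<Rightarrow> 'a. \<forall>i. p i \<in> topspace X} \<subseteq> \<Union> \<V>"
    if \<U>: "\<And>U. U \<in> \<U> \<Longrightarrow> openin (product_topology (\<lambda>_ :: nat. X) UNIV) U"
      "{p. \<forall>i. p i \<in> topspace X} \<subseteq> \<Union> \<U>" for \<U>
  proof (rule ccontr)
    assume contra: "\<nexists>\<V>. countable \<V> \<and> \<V> \<subseteq> \<U> \<and> {p :: nat \<Rightarrow> 'a. \<forall>i. p i \<in> topspace X} \<subseteq> \<Union> \<V>"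
    let ?P = "{p :: nat \<Rightarrow> 'a. \<forall>i. p i \<in> topspace X}"
    define N where "N = (\<lambda>n (\<phi> :: nat \<Rightarrow> 'a \<Rightarrow> real). {q \<in> ?P. \<forall>i<n. \<phi> i (q i) < 1})"
    have "\<forall>p\<in>?P. \<exists>s :: nat \<times> (nat \<Rightarrow> 'a \<Rightarrow> real). \<exists>U\<in>\<U>.
        (\<forall>i. continuous_map X (top_of_set {0..1}) (snd s i)) \<and> (\<forall>i. snd s i (p i) = 0) \<and>
        N (fst s) (snd s) \<subseteq> U"
    proof
      fix p assume "p \<in> ?P"
      then obtain U where U: "U \<in> \<U>" "p \<in> U"
        using \<U>(2) by blast
      obtain n and \<phi> :: "nat \<Rightarrow> 'a \<Rightarrow> real" where "\<And>i. continuous_map X (top_of_set {0..1}) (\<phi> i)"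
        "\<And>i. \<phi> i (p i) = 0" "{q. (\<forall>i. q i \<in> topspace X) \<and> (\<forall>i<n. \<phi> i (q i) < 1)} \<subseteq> U"
        by (rule completely_regular_power_basis[OF creg \<U>(1)[OF U(1)] U(2)]) auto
      then show "\<exists>s. \<exists>U\<in>\<U>. (\<forall>i. continuous_map X (top_of_set {0..1}) (snd s i)) \<and>
          (\<forall>i. snd s i (p i) = 0) \<and> N (fst s) (snd s) \<subseteq> U"
        using U(1) by (intro exI[of _ "(n, \<phi>)"] bexI[of _ U]) (simp_all add: N_def)
    qed
    then obtain s where s: "\<forall>p\<in>?P. \<exists>U\<in>\<U>.
        (\<forall>i. continuous_map X (top_of_set {0..1}) (snd (s p) i)) \<and> (\<forall>i. snd (s p) i (p i) = 0) \<and>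
        N (fst (s p)) (snd (s p)) \<subseteq> U"
      by (rule bchoice[THEN exE])
    define m where "m = (\<lambda>p. fst (s p))"
    define \<phi> where "\<phi> = (\<lambda>p. snd (s p))"
    have cont_\<phi>: "continuous_map X (top_of_set {0..1}) (\<phi> p i)" and \<phi>_0: "\<phi> p i (p i) = 0"
      if "p \<in> ?P" for p i
      using bspec[OF s that] by (auto simp: \<phi>_def)
    have N_sub: "\<exists>U\<in>\<U>. N (m p) (\<phi> p) \<subseteq> U" if "p \<in> ?P" for p
      using bspec[OF s that] by (auto simp: \<phi>_def m_def)
    \<comment> \<open>Countably many of the sets \<open>N\<close> never cover, since each lies in a
      member of the bad cover. Sequences \<open>D\<close> that leave the power get an arbitrary
      point, so that \<open>far\<close> is total.\<close>
    have "\<exists>q. q \<in> ?P \<and> ((\<forall>k. D k \<in> ?P) \<longrightarrow> (\<forall>k. q \<notin> N (m (D k)) (\<phi> (D k))))" for D :: "nat \<Rightarrow> nat \<Rightarrow> 'a"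
    proof (cases "\<forall>k. D k \<in> ?P")
      case True
      then have "\<forall>k. \<exists>U. U \<in> \<U> \<and> N (m (D k)) (\<phi> (D k)) \<subseteq> U"
        using N_sub by blast
      then obtain U where U: "\<forall>k. U k \<in> \<U> \<and> N (m (D k)) (\<phi> (D k)) \<subseteq> U k"
        by (rule choice[THEN exE])
      have "countable (range U)" "range U \<subseteq> \<U>"
        using U by auto
      then have "\<not> ?P \<subseteq> \<Union> (range U)"
        using contra by auto
      then obtain q where q: "q \<in> ?P" "q \<notin> \<Union> (range U)"
        by (meson subsetI)
      have "q \<notin> N (m (D k)) (\<phi> (D k))" for k
        using U[rule_format, of k] q(2) by auto
      then show ?thesis
        using q(1) by (intro exI[of _ q]) simp
    next
      case False
      have "?P \<noteq> {}"
      proof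
        assume "?P = {}"
        then have "?P \<subseteq> \<Union> {}"
          by simp
        then show False
          using contra countable_empty by blast
      qed
      then obtain q where "q \<in> ?P"
        by (rule ex_in_conv[THEN iffD2, THEN exE])
      then show ?thesis
        using False by (intro exI[of _ q] conjI impI) (assumption, rule notE)
    qed
    then have "\<forall>D :: nat \<Rightarrow> nat \<Rightarrow> 'a. \<exists>q. q \<in> ?P \<and>
        ((\<forall>k. D k \<in> ?P) \<longrightarrow> (\<forall>k. q \<notin> N (m (D k)) (\<phi> (D k))))"
      by blast
    then obtain far :: "(nat \<Rightarrow> nat \<Rightarrow> 'a) \<Rightarrow> nat \<Rightarrow> 'a" where far: "\<forall>D. far D \<in> ?P \<and>
        ((\<forall>k. D k \<in> ?P) \<longrightarrow> (\<forall>k. far D \<notin> N (m (D k)) (\<phi> (D k))))"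
      by (rule choice[THEN exE])
    define x0 where "x0 = far undefined 0"
    have x0: "x0 \<in> topspace X"
      using far by (simp add: x0_def)
    \<comment> \<open>Operation 0 takes limits, with \<open>x0\<close> as default. Operation
      \<open>Suc j\<close> reads the sequence as a double array, that is, as a sequence of points of
      the power, and returns the j-th coordinate of a point far from them.\<close>
    define op where "op = (\<lambda>k s. case k of
        0 \<Rightarrow> if \<exists>l. limitin X s l sequentially then SOME l. limitin X s l sequentially else x0
      | Suc j \<Rightarrow> far (\<lambda>a b. s (prod_encode (a, b))) j)"
    have op_in: "op k s \<in> topspace X" for k s
    proof (cases k)
      case 0
      show ?thesis
      proof (cases "\<exists>l. limitin X s l sequentially")
        case True
        then have "op k s = (SOME l. limitin X s l sequentially)"
          by (simp add: op_def 0)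
        then show ?thesis
          using someI_ex[OF True] limitin_topspace by metis
      qed (simp add: op_def 0 x0)
    next
      case (Suc j)
      then show ?thesis
        using far by (simp add: op_def)
    qed
    obtain A where A: "x0 \<in> A" "A \<subseteq> topspace X" "\<And>k s. range s \<subseteq> A \<Longrightarrow> op k s \<in> A"
      "A \<lesssim> (UNIV :: real set)"
      by (rule closure_lepoll_real[of x0 "topspace X" op]) (use x0 op_in in auto)
    have "closedin X A"
    proof -
      have "l \<in> A" if l: "range \<sigma> \<subseteq> A" "limitin X \<sigma> l sequentially" for \<sigma> l
      proof -
        have ex: "\<exists>l. limitin X \<sigma> l sequentially"
          using l(2) by (rule exI)
        then have "op 0 \<sigma> = (SOME l. limitin X \<sigma> l sequentially)"
          by (simp add: op_def)
        then have "limitin X \<sigma> (op 0 \<sigma>) sequentially"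
          using someI_ex[OF ex] by simp
        \<comment> \<open>Limits are unique, so closing off under one chosen limit captures every
          limit.\<close>
        then have "op 0 \<sigma> = l"
          using l(2) haus by (intro limitin_Hausdorff_unique[where F = sequentially]) auto
        then show ?thesis
          using A(3)[OF l(1), of 0] by simp
      qed
      then show ?thesis
        using assms(3) A(2) unfolding sequential_space_def by blast
    qed
    let ?Q = "{p :: nat \<Rightarrow> 'a. \<forall>i. p i \<in> A}"
    have QP: "?Q \<subseteq> ?P"
      using A(2) by blast
    obtain idx :: "real \<Rightarrow> (nat \<Rightarrow> 'a) \<times> nat" where idx: "?Q \<times> UNIV \<subseteq> range idx"
      by (rule sequence_indices_lepoll_real[OF A(4)])
    have "\<forall>pi. \<exists>r. fst pi \<in> ?Q \<longrightarrow> idx r = pi"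
    proof
      fix pi :: "(nat \<Rightarrow> 'a) \<times> nat"
      show "\<exists>r. fst pi \<in> ?Q \<longrightarrow> idx r = pi"
      proof (cases "fst pi \<in> ?Q")
        case True
        then have "pi \<in> ?Q \<times> UNIV"
          by (simp add: mem_Times_iff)
        then have "pi \<in> range idx"
          using idx by (rule rev_subsetD)
        then show ?thesis
          by auto
      next
        case False
        then show ?thesis
          by (intro exI impI) (rule notE)
      qed
    qed
    then obtain rr where rr: "\<forall>pi. fst pi \<in> ?Q \<longrightarrow> idx (rr pi) = pi"
      by (rule choice[THEN exE])
    \<comment> \<open>The coordinates are exactly the functions attached to points of the power of
      \<open>A\<close>; indices that name no such point are filled with 0.\<close>
    define e :: "'a \<Rightarrow> real \<Rightarrow> real" where
      "e = (\<lambda>x r. if fst (idx r) \<in> ?Q then \<phi> (fst (idx r)) (snd (idx r)) x else 0)"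
    have e_rr: "e x (rr (p, i)) = \<phi> p i x" if "p \<in> ?Q" for x p i
      using rr[rule_format, of "(p, i)"] that by (simp add: e_def)
    have cont_e_r: "continuous_map X (top_of_set {0..1}) (\<lambda>x. e x r)" for r
    proof (cases "fst (idx r) \<in> ?Q")
      case True
      then have "fst (idx r) \<in> ?P"
        using QP by blast
      then show ?thesis
        using cont_\<phi>[of "fst (idx r)" "snd (idx r)"] True by (simp add: e_def)
    next
      case False
      then have "e x r = 0" for x
        by (auto simp: e_def)
      then show ?thesis
        by simp
    qed
    then have "continuous_map X euclidean (\<lambda>x. e x r)" for r
      using continuous_map_into_fulltopology by blast
    then have "continuous_map X (product_topology (\<lambda>_. euclidean) UNIV) e"
      unfolding continuous_map_componentwise_UNIV by blast
    then have cont_e: "continuous_map X euclidean e"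
      by (simp add: euclidean_product_topology)
    let ?Z = "e ` A"
    have fac: "Lindelof_factor ?Z"
      by (rule productively_Lindelof_imp_Lindelof_factor[OF assms(2) \<open>closedin X A\<close> cont_e])
    have cube: "?Z \<subseteq> cube"
    proof
      fix z assume "z \<in> ?Z"
      then obtain x where x: "x \<in> topspace X" "z = e x"
        using A(2) by blast
      have "e x r \<in> {0..1}" for r
        using continuous_map_funspace[OF cont_e_r[of r]] x(1) by auto
      then show "z \<in> cube"
        by (simp add: cube_def x(2))
    qed
    \<comment> \<open>For \<open>p\<close> in the power of \<open>A\<close>, the set
      \<open>N (m p) (\<phi> p)\<close> consists of the points of the power of \<open>X\<close>
      whose coordinatewise image under \<open>e\<close> lies in \<open>B p\<close>, which is how the
      cover descends.\<close>
    define B where "B = (\<lambda>p. {f :: nat \<Rightarrow> real \<Rightarrow> real. \<forall>i<m p. f i (rr (p, i)) < 1})"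
    have open_B: "open (B p)" for p
    proof -
      have "continuous_on UNIV (\<lambda>f :: nat \<Rightarrow> real \<Rightarrow> real. f i r)" for i r
        by (rule continuous_on_compose2[OF continuous_coordinate continuous_on_product_coordinates]) simp
      then have "open {f :: nat \<Rightarrow> real \<Rightarrow> real. f i r < 1}" for i r
        by (intro open_Collect_less continuous_on_const)
      then have "open (\<Inter>i\<in>{..<m p}. {f :: nat \<Rightarrow> real \<Rightarrow> real. f i (rr (p, i)) < 1})"
        by (intro open_INT) auto
      moreover have "B p = (\<Inter>i\<in>{..<m p}. {f. f i (rr (p, i)) < 1})"
        by (auto simp: B_def)
      ultimately show ?thesis
        by simp
    qed
    have cover: "{z :: nat \<Rightarrow> real \<Rightarrow> real. \<forall>i. z i \<in> ?Z} \<subseteq> \<Union> (B ` ?Q)"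
    proof
      fix z :: "nat \<Rightarrow> real \<Rightarrow> real" assume "z \<in> {z. \<forall>i. z i \<in> ?Z}"
      then have "\<forall>i. \<exists>x. x \<in> A \<and> z i = e x"
        by blast
      then obtain p where p: "\<forall>i. p i \<in> A \<and> z i = e (p i)"
        by (rule choice[THEN exE])
      then have "p \<in> ?Q"
        by blast
      then have "z i (rr (p, i)) = 0" for i
        using e_rr[of p "p i" i] \<phi>_0[of p i] QP p by auto
      then have "z \<in> B p"
        by (simp add: B_def)
      then show "z \<in> \<Union> (B ` ?Q)"
        using \<open>p \<in> ?Q\<close> by blast
    qed
    have "\<exists>\<V>\<subseteq>B ` ?Q. countable \<V> \<and> {z :: nat \<Rightarrow> real \<Rightarrow> real. \<forall>i. z i \<in> ?Z} \<subseteq> \<Union> \<V>"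
    proof (rule Alster_imp_power_Lindelof[OF Lindelof_factor_imp_Alster[OF lt fac cube] _ cover])
      fix U assume "U \<in> B ` ?Q"
      then show "open U"
        using open_B by (elim imageE) simp
    qed
    then obtain \<V> where \<V>: "\<V> \<subseteq> B ` ?Q" "countable \<V>" "{z :: nat \<Rightarrow> real \<Rightarrow> real. \<forall>i. z i \<in> ?Z} \<subseteq> \<Union> \<V>"
      by (elim exE conjE)
    obtain E where E: "countable E" "E \<subseteq> ?Q" "\<V> = B ` E"
      using countable_subset_image[THEN iffD1, OF conjI[OF \<V>(2,1)]] by (elim exE conjE)
    have "(\<lambda>_. e x0) \<in> {z :: nat \<Rightarrow> real \<Rightarrow> real. \<forall>i. z i \<in> ?Z}"
      using A(1) by simp
    then have "(\<lambda>_. e x0) \<in> \<Union> \<V>"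
      by (rule subsetD[OF \<V>(3)])
    then have "E \<noteq> {}"
      using E(3) by blast
    \<comment> \<open>The centres of the countable subcover are enumerated inside the power of
      \<open>A\<close>. Closure under \<open>op\<close> keeps \<open>far D\<close> there, so its
      image is covered by some \<open>B p\<close>, although \<open>far D\<close> was chosen outside
      every \<open>N\<close> along \<open>D\<close>.\<close>
    define D where "D = from_nat_into E"
    have D: "D k \<in> ?Q" for k
      using from_nat_into[OF \<open>E \<noteq> {}\<close>] E(2) by (auto simp: D_def)
    have "far D j \<in> A" for j
    proof -
      have "range (\<lambda>n. D (fst (prod_decode n)) (snd (prod_decode n))) \<subseteq> A"
        using D by blast
      from A(3)[OF this, of "Suc j"] show ?thesis
        by (simp add: op_def)
    qed
    then have "(\<lambda>i. e (far D i)) \<in> {z. \<forall>i. z i \<in> ?Z}"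
      by simp
    then have "(\<lambda>i. e (far D i)) \<in> \<Union> \<V>"
      by (rule subsetD[OF \<V>(3)])
    then obtain p where p: "p \<in> E" "(\<lambda>i. e (far D i)) \<in> B p"
      using E(3) by blast
    obtain k where k: "D k = p"
      using from_nat_into_surj[OF E(1) p(1)] by (auto simp: D_def)
    have "p \<in> ?Q"
      using p(1) E(2) by (rule rev_subsetD)
    have "\<phi> p i (far D i) < 1" if "i < m p" for i
    proof -
      have "e (far D i) (rr (p, i)) < 1"
        using p(2) that by (simp add: B_def)
      then show ?thesis
        by (simp add: e_rr[OF \<open>p \<in> ?Q\<close>])
    qed
    then have "far D \<in> N (m (D k)) (\<phi> (D k))"
      using far by (simp add: N_def k)
    moreover have "\<forall>k. D k \<in> ?P"
      using D QP by (intro allI) (rule subsetD)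
    then have "\<forall>k. far D \<notin> N (m (D k)) (\<phi> (D k))"
      by (rule mp[OF conjunct2[OF spec[OF far]]])
    ultimately show False
      by simp
  qed
  then show ?thesis
    unfolding powerfully_Lindelof_def Lindelof_space_alt topX by simp
qed

end
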